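(* Let $1\le N<L$ be integers, $0<p<1$, and $\vec x=(x_1,\dots,x_N),\vec y=(y_1,\dots,y_N)\in\mathcal X_N^{(L)}$. Let $P_t(\vec y\to\vec x)$, $t\in\mathbb Z_{\ge0}$, be the probability that discrete time periodic parallel TASEP with initial configuration $\vec y$ is in configuration $\vec x$ at time $t$. With the convention $x_0:=x_N+L$, $$P_t(\vec y\to\vec x)=\prod_{i=1}^N\big(1-p\mathbf 1_{x_{i-1}-x_i=1}\big)\oint_\Gamma\frac{dz}{2\pi iz}\det\Big[\sum_{w\in\mathcal S_z}F_{i,j}(w;\vec x,\vec y,t)J(w)\Big]_{i,j=1}^N,$$ where $\Gamma$ is any simple closed contour with $0$ inside, $\mathcal S_z=\{w\in\mathbb C:w^N(w+1)^{L-N}-z^L(1+pw)^N=0\}$, $$F_{i,j}(w;\vec x,\vec y,t)=w^{j-i}(w+1)^{-x_{N-i+1}+y_{N-j+1}+i-j-1}(1+pw)^{t+i-j},\qquad 1\le i,j\le N,$$ and $$J(w)=\frac{w(w+1)(1+pw)}{N+Lw+p(L-N)w^2}.$$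
   Context: $\mathcal X_N^{(L)}=\{(x_1,\dots,x_N)\in\mathbb Z^N:x_N+L>x_1>x_2>\cdots>x_N\}$. A configuration $\vec x\in\mathcal X_N^{(L)}$ represents the periodic particle system on $\mathbb Z$ with particles at $x_{i+kN}=x_i-kL$, $1\le i\le N$, $k\in\mathbb Z$. Discrete time periodic parallel TASEP is the Markov chain on $\mathcal X_N^{(L)}$ in which at each time step each of the $N$ particles in a period (together with its periodic copies) independently jumps one site to the right with probability $p$ provided that the right neighboring site is currently empty, otherwise it stays; all updates are simultaneous. Configurations differing by a translation by a multiple of the period are distinguished. At the isolated values of $z\neq0$ for which $w^N(w+1)^{L-N}-z^L(1+pw)^N$ has multiple roots, the sums over $\mathcal S_z$ are understood by analytic continuation in $z$. *)

theory Defs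
  imports
    "HOL-Complex_Analysis.Complex_Analysis"
    "HOL-Probability.Probability"
    "Jordan_Normal_Form.Determinant"
begin

text \<open>
  A configuration is an extensional function on \<open>{1..N}\<close>, so that equality of configurations
  is equality of the tuples \<open>(x 1, \<dots>, x N)\<close>.
\<close>

definition configs :: "nat \<Rightarrow> nat \<Rightarrow> (nat \<Rightarrow> int) set" where
  "configs N L =
     {x \<in> {1..N} \<rightarrow>\<^sub>E UNIV. strict_antimono_on {1..N} x \<and> x 1 < x N + int L}"

definition occupied :: "nat \<Rightarrow> nat \<Rightarrow> (nat \<Rightarrow> int) \<Rightarrow> int set" where
  "occupied N L x = {x i - k * int L | i k. i \<in> {1..N}}"

text \<open>
  The displacements of the \<open>N\<close> particles are independent given the current configuration \<open>x\<close>, and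
  all of them are decided by \<open>x\<close> itself (parallel update). The default value \<open>undefined\<close> of the
  product measure keeps the new configuration extensional.
\<close>

definition tasep_step :: "nat \<Rightarrow> nat \<Rightarrow> real \<Rightarrow> (nat \<Rightarrow> int) \<Rightarrow> (nat \<Rightarrow> int) pmf" where
  "tasep_step N L p x =
     Pi_pmf {1..N} undefined
       (\<lambda>i. if x i + 1 \<notin> occupied N L x
            then map_pmf (\<lambda>b. if b then x i + 1 else x i) (bernoulli_pmf p)
            else return_pmf (x i))"

primrec tasep_pmf :: "nat \<Rightarrow> nat \<Rightarrow> real \<Rightarrow> nat \<Rightarrow> (nat \<Rightarrow> int) \<Rightarrow> (nat \<Rightarrow> int) pmf" where
  "tasep_pmf N L p 0 y = return_pmf y"
| "tasep_pmf N L p (Suc t) y = bind_pmf (tasep_pmf N L p t y) (tasep_step N L p)"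

definition trans_prob ::
    "nat \<Rightarrow> nat \<Rightarrow> real \<Rightarrow> nat \<Rightarrow> (nat \<Rightarrow> int) \<Rightarrow> (nat \<Rightarrow> int) \<Rightarrow> real" where
  "trans_prob N L p t y x = pmf (tasep_pmf N L p t y) x"

text \<open>The coordinate \<open>x\<^sub>i\<^sub>-\<^sub>1\<close>, where \<open>x\<^sub>0 = x\<^sub>N + L\<close>.\<close>

definition right_nbr :: "nat \<Rightarrow> nat \<Rightarrow> (nat \<Rightarrow> int) \<Rightarrow> nat \<Rightarrow> int" where
  "right_nbr N L x i = (if i = 1 then x N + int L else x (i - 1))"

definition bethe_roots :: "nat \<Rightarrow> nat \<Rightarrow> real \<Rightarrow> complex \<Rightarrow> complex set" where
  "bethe_roots N L p z =
     {w. w ^ N * (w + 1) ^ (L - N) - z ^ L * (1 + of_real p * w) ^ N = 0}"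

definition F_fun ::
    "nat \<Rightarrow> real \<Rightarrow> nat \<Rightarrow> nat \<Rightarrow> (nat \<Rightarrow> int) \<Rightarrow> (nat \<Rightarrow> int) \<Rightarrow> nat \<Rightarrow> complex \<Rightarrow> complex" where
  "F_fun N p i j x y t w =
     w powi (int j - int i)
     * (w + 1) powi (- x (N - i + 1) + y (N - j + 1) + int i - int j - 1)
     * (1 + of_real p * w) powi (int t + int i - int j)"

definition J_fun :: "nat \<Rightarrow> nat \<Rightarrow> real \<Rightarrow> complex \<Rightarrow> complex" where
  "J_fun N L p w =
     w * (w + 1) * (1 + of_real p * w)
     / (of_nat N + of_nat L * w + of_real p * of_nat (L - N) * w ^ 2)"

text \<open>
  The denominator of \<open>J_fun\<close> vanishes at a root \<open>w \<in> bethe_roots N L p z\<close> (for \<open>z \<noteq> 0\<close>) exactly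
  if \<open>w\<close> is a multiple root, which happens for finitely many \<open>z\<close>. There the sum over the roots is
  replaced by its analytic continuation in \<open>z\<close>: \<^const>\<open>remove_sings\<close> takes the value to be the
  limit at \<open>z\<close> over punctured neighbourhoods, which at every other \<open>z \<noteq> 0\<close> is just the sum itself.
\<close>

definition root_sum ::
    "nat \<Rightarrow> nat \<Rightarrow> real \<Rightarrow> nat \<Rightarrow> nat \<Rightarrow> (nat \<Rightarrow> int) \<Rightarrow> (nat \<Rightarrow> int) \<Rightarrow> nat \<Rightarrow> complex \<Rightarrow> complex"
  where
  "root_sum N L p i j x y t =
     remove_sings (\<lambda>z. \<Sum>w\<in>bethe_roots N L p z. F_fun N p i j x y t w * J_fun N L p w)"

text \<open>\<^const>\<open>Matrix.mat\<close> indexes from 0, hence the shift of the indices.\<close>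

definition root_sum_mat ::
    "nat \<Rightarrow> nat \<Rightarrow> real \<Rightarrow> (nat \<Rightarrow> int) \<Rightarrow> (nat \<Rightarrow> int) \<Rightarrow> nat \<Rightarrow> complex \<Rightarrow> complex Matrix.mat"
  where
  "root_sum_mat N L p x y t z =
     Matrix.mat N N (\<lambda>(i, j). root_sum N L p (i + 1) (j + 1) x y t z)"

text \<open>The winding number fixes the counterclockwise orientation.\<close>

definition simple_contour_around :: "(real \<Rightarrow> complex) \<Rightarrow> complex \<Rightarrow> bool" where
  "simple_contour_around \<Gamma> a \<longleftrightarrow>
     valid_path \<Gamma> \<and> simple_path \<Gamma> \<and> pathfinish \<Gamma> = pathstart \<Gamma>
     \<and> a \<in> inside (path_image \<Gamma>) \<and> winding_number \<Gamma> a = 1"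

end

theory Submission
  imports Defs "HOL-Library.Groups_Big_Fun"
begin

text \<open>
  The proof replaces the Bethe roots by residues at two fixed points, after which the formula becomes
  an identity between constant terms of determinants of Laurent polynomials in \<open>z ^ L\<close>.

  \<^bold>\<open>Removing the roots.\<close> At a simple root \<open>w\<close> the factor \<open>J w\<close> is \<open>w ^ N * (w + 1) ^ (L - N)\<close> divided
  by the \<open>w\<close>-derivative of the Bethe polynomial, so the sum of \<open>f w * J w\<close> over the roots is a sum of
  residues. For a monomial \<open>f\<close> in \<open>w\<close>, \<open>w + 1\<close>, \<open>1 + p w\<close> the function \<open>f\<close> may be multiplied, without changing its values
  on the roots, by any power of \<open>\<rho> = z ^ L * (1 + p w) ^ N / (w ^ N * (w + 1) ^ (L - N))\<close>.
  A large negative power removes the poles at \<open>0\<close> and \<open>-1\<close>, a large positive power those at \<open>-1/p\<close>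
  and infinity. Comparing the two choices by a geometric sum gives
  \<open>\<Sum>\<^sub>w f w * J w = \<Sum>\<^sub>m (Res\<^sub>0 + Res\<^sub>-\<^sub>1) (f * \<rho> ^ m)\<close>, summed over all integers \<open>m\<close>, a Laurent polynomial in
  \<open>z ^ L\<close> (\<open>sum_bethe_roots_eq_root_trace\<close>). It extends the root sum across
  the values of \<open>z\<close> with multiple roots, and the contour integral just extracts the coefficient of
  \<open>z ^ 0\<close> of the determinant.

  \<^bold>\<open>Evolution.\<close> Divide the transition probability by the prefactor of the formula. The quotient
  satisfies an equation in which all particles hop back freely, except that a particle with another
  one directly behind it cannot have moved (\<open>trans_prob_Suc\<close>). On the determinant side, one time step
  multiplies every row by \<open>1 + p w = (1 - p) + p (w + 1)\<close>, and a factor \<open>w + 1\<close> moves the particle of that row one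
  step back, so multilinearity gives the free equation. For a particle with a neighbour directly behind, the factor
  \<open>1 + p w\<close> can be removed by subtracting \<open>p\<close> times the row of this neighbour. These row operations
  have determinant \<open>1\<close> although they are arranged cyclically, because \<open>N < L\<close> prevents all gaps from
  being closed (\<open>det_bethe_mat_tailed\<close>).

  \<^bold>\<open>Initial condition.\<close> At time \<open>0\<close> the constant term is a sum over permutations combined with shifts by
  multiples of \<open>N\<close> of total degree zero, that is, over affine permutations of the integers. After the
  same row operations, the vanishing of the residues leaves the identity permutation alone
  (\<open>affine_permutation_trivial\<close>), and its term is nonzero only for \<open>x = y\<close>.
\<close>

section \<open>Auxiliary facts on residues, sums and determinants\<close>

text \<open>
  The integral over a large circle is \<open>2 \<pi> \<i>\<close> times this sum, independently of the radius, and the decay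
  makes it tend to zero: there is no residue at infinity.
\<close>

lemma sum_residues_eq_0:
  assumes S: "finite S" and hol: "f holomorphic_on - S"
    and lim: "((\<lambda>w. w * f w) \<longlongrightarrow> 0) at_infinity"
  shows "(\<Sum>s\<in>S. residue f s) = 0"
proof -
  define c where "c = (\<Sum>s\<in>S. residue f s)"
  obtain r0 where r0: "S \<subseteq> ball 0 r0" "r0 > 0"
    using finite_imp_bounded[OF S] bounded_subset_ballD by blast
  have bound: "norm c \<le> e" if e: "e > 0" for e :: real
  proof -
    have "\<forall>\<^sub>F w in at_infinity. norm (w * f w) < e"
      using tendstoD[OF lim e] by (simp add: dist_norm)
    then obtain b where b: "\<And>w. norm w \<ge> b \<Longrightarrow> norm (w * f w) < e"
      unfolding eventually_at_infinity by blast
    \<comment> \<open>large enough to enclose \<open>S\<close> and to make \<open>w * f w\<close> small on the circle\<close>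
    define r where "r = max b r0"
    have r: "r > 0" "r \<ge> b" "r \<ge> r0" using r0 by (auto simp: r_def)
    have hol': "f holomorphic_on UNIV - S" using hol by (simp add: Compl_eq_Diff_UNIV)
    have img: "path_image (circlepath 0 r) \<subseteq> UNIV - S"
      using r r0 by (auto simp: path_image_circlepath)
    have "contour_integral (circlepath 0 r) f
            = 2 * pi * \<i> * (\<Sum>s\<in>S. winding_number (circlepath 0 r) s * residue f s)"
      using S hol' img by (intro Residue_theorem[of UNIV]) auto
    also have "(\<Sum>s\<in>S. winding_number (circlepath 0 r) s * residue f s) = c"
      unfolding c_def
    proof (intro sum.cong refl)
      fix s assume "s \<in> S"
      then have "norm (s - 0) < r" using r0 r by auto
      then show "winding_number (circlepath 0 r) s * residue f s = residue f s"
        by (subst winding_number_circlepath) auto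
    qed
    finally have eq: "contour_integral (circlepath 0 r) f = 2 * pi * \<i> * c" .
    have "f contour_integrable_on circlepath 0 r"
      using S hol' img by (intro contour_integrable_holomorphic_simple[of _ "UNIV - S"])
        (auto intro: open_Diff finite_imp_closed)
    then have "(f has_contour_integral (2 * pi * \<i> * c)) (circlepath 0 r)"
      using eq has_contour_integral_integral by metis
    moreover have "norm (f w) \<le> e / r" if "norm (w - 0) = r" for w
    proof -
      have "norm (w * f w) < e" using b that r by auto
      then show ?thesis using that r by (simp add: norm_mult field_simps)
    qed
    ultimately have "norm (2 * pi * \<i> * c) \<le> e / r * (2 * pi * r)"
      using e r by (intro has_contour_integral_bound_circlepath) auto
    then show ?thesis using r by (simp add: norm_mult)
  qed
  have "norm c \<le> 0" by (rule field_le_epsilon) (use bound in auto)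
  then show ?thesis by (simp add: c_def)
qed

lemma residue_cong_nhd:
  assumes "open A" "s \<in> A" "\<And>w. w \<in> A - {s} \<Longrightarrow> f w = g w"
  shows "residue f s = residue g s"
  by (rule residue_cong) (use assms in \<open>auto simp: eventually_at_filter elim!: eventually_mono[OF eventually_nhds_in_open]\<close>)

lemma sum_telescope_int:
  fixes f :: "int \<Rightarrow> 'a::ab_group_add"
  shows "(\<Sum>m\<in>{- int M..<int M}. f m - f (m + 1)) = f (- int M) - f (int M)"
proof (induction M)
  case (Suc M)
  have "{- int (Suc M)..<int (Suc M)} = insert (- int M - 1) (insert (int M) {- int M..<int M})"
    by auto
  moreover have "f (- int M - 1) = f (- 1 - int M)" by (rule arg_cong[where f = f]) simp
  ultimately show ?case using Suc by (simp add: add.commute)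
qed simp

lemma mono_on_int_of_step:
  fixes f :: "int \<Rightarrow> int"
  assumes "\<And>k. f k \<le> f (k + 1)" "k \<le> l"
  shows "f k \<le> f l"
  using assms(2) by (induction rule: int_ge_induct) (use assms(1) order.trans in blast)+

lemma cyclic_nat_induct:
  fixes N :: nat
  assumes start: "i0 < N" "P i0"
    and up: "\<And>i. 0 < i \<Longrightarrow> i < N \<Longrightarrow> P (i - 1) \<Longrightarrow> P i"
    and wrap: "P (N - 1) \<Longrightarrow> P 0"
    and "i < N"
  shows "P i"
proof -
  have climb: "P k" if "P j" "j \<le> k" "k < N" for j k
    using that(2,3,1)
  proof (induction k rule: dec_induct)
    case (step k)
    then show ?case using up[of "Suc k"] by simp
  qed
  have "P 0" using wrap climb[of i0 "N - 1"] start by simp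
  then show ?thesis using climb[of 0 i] assms(5) by simp
qed

lemma det_only_identity:
  fixes A :: "'a::comm_ring_1 Matrix.mat"
  assumes A: "A \<in> carrier_mat n n"
    and only_id: "\<And>\<pi>. \<pi> permutes {0..<n} \<Longrightarrow> (\<And>i. i < n \<Longrightarrow> A $$ (i, \<pi> i) \<noteq> 0) \<Longrightarrow> \<pi> = id"
  shows "Determinant.det A = (\<Prod>i<n. A $$ (i, i))"
proof -
  have "Determinant.det A = (\<Sum>\<pi>\<in>{\<pi>. \<pi> permutes {0..<n}}. signof \<pi> * (\<Prod>i = 0..<n. A $$ (i, \<pi> i)))"
    by (rule det_def'[OF A])
  also have "\<dots> = (\<Sum>\<pi>\<in>{id}. signof \<pi> * (\<Prod>i = 0..<n. A $$ (i, \<pi> i)))"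
  proof (rule sum.mono_neutral_right)
    show "\<forall>\<pi>\<in>{\<pi>. \<pi> permutes {0..<n}} - {id}. signof \<pi> * (\<Prod>i = 0..<n. A $$ (i, \<pi> i)) = 0"
    proof
      fix \<pi> assume "\<pi> \<in> {\<pi>. \<pi> permutes {0..<n}} - {id}"
      then obtain i where "i < n" "A $$ (i, \<pi> i) = 0" using only_id by blast
      then have "(\<Prod>i = 0..<n. A $$ (i, \<pi> i)) = 0" by (intro prod_zero) auto
      then show "signof \<pi> * (\<Prod>i = 0..<n. A $$ (i, \<pi> i)) = 0" by simp
    qed
  qed (auto simp: finite_permutations permutes_id)
  finally show ?thesis by (simp add: lessThan_atLeast0)
qed

section \<open>Monomials in \<open>w\<close>, \<open>w + 1\<close> and \<open>1 + p w\<close>\<close>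

locale periodic_tasep =
  fixes N L :: nat and p :: real
  assumes N_pos: "1 \<le> N" and N_less: "N < L" and p_pos: "0 < p" and p_less: "p < 1"
begin

definition bethe_monom :: "int \<Rightarrow> int \<Rightarrow> int \<Rightarrow> complex \<Rightarrow> complex" where
  "bethe_monom a b c w = w powi a * (w + 1) powi b * (1 + of_real p * w) powi c"

definition pole :: complex where
  "pole = - 1 / of_real p"

lemma linear_factor_eq_0_iff: "1 + of_real p * w = 0 \<longleftrightarrow> w = pole"
proof -
  have "complex_of_real p \<noteq> 0" using p_pos by simp
  then show ?thesis by (auto simp: pole_def field_simps add_eq_0_iff)
qed

lemma factors_nonzero:
  assumes "w \<notin> {0, -1, pole}"
  shows "w \<noteq> 0" "w + 1 \<noteq> 0" "1 + of_real p * w \<noteq> 0"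
proof -
  show "w \<noteq> 0" "1 + of_real p * w \<noteq> 0" using assms linear_factor_eq_0_iff by auto
  show "w + 1 \<noteq> 0" using assms by (metis add_eq_0_iff2 insertI1 insert_commute)
qed

lemma pole_neq: "pole \<noteq> 0" "pole \<noteq> -1"
proof -
  have "complex_of_real p \<noteq> 0" "complex_of_real p \<noteq> 1" using p_pos p_less by auto
  then show "pole \<noteq> 0" "pole \<noteq> -1" by (auto simp: pole_def field_simps)
qed

lemma bethe_monom_holomorphic:
  assumes "a \<ge> 0 \<or> 0 \<notin> A" "b \<ge> 0 \<or> -1 \<notin> A" "c \<ge> 0 \<or> pole \<notin> A"
  shows "bethe_monom a b c holomorphic_on A"
proof -
  have [holomorphic_intros]: "(\<lambda>w. g w powi n) holomorphic_on A"
    if "g holomorphic_on A" "n \<ge> 0 \<or> (\<forall>w\<in>A. g w \<noteq> 0)" for n and g :: "complex \<Rightarrow> complex"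
  proof (cases "n \<ge> 0")
    case True
    then show ?thesis using that(1) by (auto simp: power_int_nonneg_exp intro!: holomorphic_intros)
  next
    case False
    then show ?thesis using that by (auto intro!: holomorphic_intros)
  qed
  show ?thesis
    unfolding bethe_monom_def
    using assms linear_factor_eq_0_iff
    by (intro holomorphic_intros) (auto simp: add_eq_0_iff2)
qed

lemma bethe_monom_mult:
  assumes "w \<notin> {0, -1, pole}"
  shows "bethe_monom a b c w * bethe_monom a' b' c' w = bethe_monom (a + a') (b + b') (c + c') w"
  using factors_nonzero[OF assms] by (simp add: bethe_monom_def power_int_add mult_ac)

lemma bethe_monom_nonzero:
  assumes "w \<notin> {0, -1, pole}"
  shows "bethe_monom a b c w \<noteq> 0"
  using factors_nonzero[OF assms] by (simp add: bethe_monom_def)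

text \<open>At infinity each of the three factors grows like a multiple of \<open>w\<close>, so only the total degree matters.\<close>

lemma bethe_monom_tendsto_0:
  assumes "a + b + c < 0"
  shows "(bethe_monom a b c \<longlongrightarrow> 0) at_infinity"
proof -
  have inv: "((\<lambda>w::complex. inverse w) \<longlongrightarrow> 0) at_infinity" by (rule tendsto_inverse_0)
  have "((\<lambda>w::complex. (inverse w) ^ nat (- (a + b + c)) * (1 + inverse w) powi b
          * (inverse w + of_real p) powi c) \<longlongrightarrow> 0 ^ nat (- (a + b + c)) * (1 + 0) powi b * (0 + of_real p) powi c)
        at_infinity"
    using p_pos by (intro tendsto_mult tendsto_power tendsto_power_int tendsto_add tendsto_const inv) auto
  moreover have "(0::complex) ^ nat (- (a + b + c)) = 0" using assms by simp
  ultimately have lim: "((\<lambda>w::complex. (inverse w) ^ nat (- (a + b + c)) * (1 + inverse w) powi b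
          * (inverse w + of_real p) powi c) \<longlongrightarrow> 0) at_infinity"
    by (simp only: mult_zero_left)
  show ?thesis
  proof (rule Lim_transform_eventually[OF lim])
    have "\<forall>\<^sub>F w::complex in at_infinity. w \<noteq> 0"
      by (rule eventually_not_equal_at_infinity)
    then show "\<forall>\<^sub>F w in at_infinity. (inverse w) ^ nat (- (a + b + c)) * (1 + inverse w) powi b
          * (inverse w + of_real p) powi c = bethe_monom a b c w"
    proof eventually_elim
      case (elim w)
      have e1: "1 + inverse w = (w + 1) * inverse w" "inverse w + of_real p = (1 + of_real p * w) * inverse w"
        using elim by (auto simp: field_simps)
      have e2: "(inverse w) ^ nat (- (a + b + c)) = w powi (a + b + c)"
        using assms by (simp add: power_int_def)
      have cancel: "w powi (a + b + c) * inverse w powi b * inverse w powi c = w powi a"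
        using elim by (simp add: power_int_add power_int_inverse field_simps)
      have "(inverse w) ^ nat (- (a + b + c)) * (1 + inverse w) powi b * (inverse w + of_real p) powi c
          = (w powi (a + b + c) * inverse w powi b * inverse w powi c) * (w + 1) powi b * (1 + of_real p * w) powi c"
        unfolding e1 e2 power_int_mult_distrib by (simp only: mult_ac)
      then show ?case unfolding cancel by (simp only: bethe_monom_def)
    qed
  qed
qed

text \<open>
  The remaining singularities of a monomial are \<open>-1/p\<close> and infinity. So the sum of the residues at
  \<open>0\<close> and \<open>-1\<close> vanishes if the monomial has no residue at these two points, and likewise if it has
  none at the other two.
\<close>

definition inner_res :: "int \<Rightarrow> int \<Rightarrow> int \<Rightarrow> complex" where
  "inner_res a b c = residue (bethe_monom a b c) 0 + residue (bethe_monom a b c) (-1)"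

lemma open_avoiding: "open (- ({0, -1, pole} - {s}))"
  by (intro open_Compl finite_imp_closed) auto

text \<open>
  Linear relations between monomials are only used away from the three special points, where negative
  powers of zero do not interfere; residues do not see the values there.
\<close>

lemma residue_bethe_monom_split:
  assumes "\<And>w. w \<notin> {0, -1, pole} \<Longrightarrow> bethe_monom a b c w = u * bethe_monom a' b' c' w + v * bethe_monom a'' b'' c'' w"
  shows "residue (bethe_monom a b c) s = u * residue (bethe_monom a' b' c') s + v * residue (bethe_monom a'' b'' c'') s"
proof -
  define A where "A = - ({0, -1, pole} - {s})"
  have A: "open A" "s \<in> A" unfolding A_def using open_avoiding by auto
  have hol: "bethe_monom a b c holomorphic_on A - {s}" for a b c
    by (rule bethe_monom_holomorphic) (auto simp: A_def)
  have "residue (bethe_monom a b c) s = residue (\<lambda>w. u * bethe_monom a' b' c' w + v * bethe_monom a'' b'' c'' w) s"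
    using A by (rule residue_cong_nhd) (use assms in \<open>auto simp: A_def\<close>)
  also have "\<dots> = residue (\<lambda>w. u * bethe_monom a' b' c' w) s + residue (\<lambda>w. v * bethe_monom a'' b'' c'' w) s"
    using A hol by (intro residue_add[of A]) (auto intro!: holomorphic_intros)
  also have "\<dots> = u * residue (bethe_monom a' b' c') s + v * residue (bethe_monom a'' b'' c'') s"
    using A hol by (simp add: residue_lmul[of A])
  finally show ?thesis .
qed

lemma inner_res_split:
  assumes "\<And>w. w \<notin> {0, -1, pole} \<Longrightarrow> bethe_monom a b c w = u * bethe_monom a' b' c' w + v * bethe_monom a'' b'' c'' w"
  shows "inner_res a b c = u * inner_res a' b' c' + v * inner_res a'' b'' c''"
  using residue_bethe_monom_split[OF assms] by (simp add: inner_res_def algebra_simps)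

text \<open>The expansion \<open>1 + p w\<close>, used for the row operations of the determinant.\<close>

lemma inner_res_pole_factor: "inner_res a b c = inner_res a b (c - 1) + of_real p * inner_res (a + 1) b (c - 1)"
proof -
  have "inner_res a b c = 1 * inner_res a b (c - 1) + of_real p * inner_res (a + 1) b (c - 1)"
  proof (rule inner_res_split)
    fix w assume w: "w \<notin> {0, -1, pole}"
    note nz = factors_nonzero[OF w]
    then have "(1 + of_real p * w) powi c = (1 + of_real p * w) powi (c - 1) * (1 + of_real p * w)"
      by (subst power_int_minus_mult) auto
    then show "bethe_monom a b c w = 1 * bethe_monom a b (c - 1) w + of_real p * bethe_monom (a + 1) b (c - 1) w"
      using nz by (simp add: bethe_monom_def power_int_add algebra_simps)
  qed
  then show ?thesis by simp
qed

text \<open>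
  The expansion \<open>1 + p w = (1 - p) + p (w + 1)\<close>: one time step either leaves a particle where it
  is or, with the factor \<open>w + 1\<close>, has moved it by one site.
\<close>

lemma inner_res_hop: "inner_res a b (c + 1) = (1 - of_real p) * inner_res a b c + of_real p * inner_res a (b + 1) c"
proof (rule inner_res_split)
  fix w assume w: "w \<notin> {0, -1, pole}"
  note nz = factors_nonzero[OF w]
  have "(1 + of_real p * w) powi (c + 1) = (1 + of_real p * w) powi c * (1 + of_real p * w)"
       "(w + 1) powi (b + 1) = (w + 1) powi b * (w + 1)"
    using nz by (auto intro: power_int_add_1)
  moreover have "A * B * (C * (1 + q * w)) = (1 - q) * (A * B * C) + q * (A * (B * (w + 1)) * C)"
    for A B C q :: complex by (simp add: algebra_simps)
  ultimately show "bethe_monom a b (c + 1) w = (1 - of_real p) * bethe_monom a b c w + of_real p * bethe_monom a (b + 1) c w"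
    unfolding bethe_monom_def by (simp only:)
qed

lemma inner_res_eq_0_nonneg:
  assumes "a \<ge> 0" "b \<ge> 0"
  shows "inner_res a b c = 0"
proof -
  have "residue (bethe_monom a b c) s = 0" if "s \<noteq> pole" for s
    using that assms by (intro residue_holo[of "- {pole}"] bethe_monom_holomorphic) auto
  then show ?thesis using pole_neq by (simp add: inner_res_def)
qed

lemma inner_res_eq_0_infinity:
  assumes "c \<ge> 0" "a + b + c \<le> -2"
  shows "inner_res a b c = 0"
proof -
  have "(\<Sum>s\<in>{0, -1}. residue (bethe_monom a b c) s) = 0"
  proof (rule sum_residues_eq_0)
    show "bethe_monom a b c holomorphic_on - {0, -1}"
      using assms by (intro bethe_monom_holomorphic) auto
    have lim: "(bethe_monom (a + 1) b c \<longlongrightarrow> 0) at_infinity"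
      using assms by (intro bethe_monom_tendsto_0) auto
    show "((\<lambda>w. w * bethe_monom a b c w) \<longlongrightarrow> 0) at_infinity"
      by (rule Lim_transform_eventually[OF lim])
        (use eventually_not_equal_at_infinity[of 0] in
          \<open>eventually_elim, auto simp: bethe_monom_def power_int_add\<close>)
  qed auto
  then show ?thesis by (simp add: inner_res_def)
qed

lemma inner_res_simple_pole: "inner_res 0 (-1) c = (1 - of_real p) powi c"
proof -
  have 0: "residue (bethe_monom 0 (-1) c) 0 = 0"
    using pole_neq by (intro residue_holo[of "- {-1, pole}"] bethe_monom_holomorphic) (auto intro: finite_imp_closed)
  have hol: "bethe_monom 0 0 c holomorphic_on - {pole}" by (intro bethe_monom_holomorphic) auto
  have "residue (\<lambda>w. bethe_monom 0 0 c w / (w - (-1))) (-1) = bethe_monom 0 0 c (-1)"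
    using pole_neq by (intro residue_simple[of "- {pole}"] hol) auto
  moreover have "(\<lambda>w. bethe_monom 0 0 c w / (w - (-1))) = bethe_monom 0 (-1) c"
    by (auto simp: bethe_monom_def fun_eq_iff power_int_minus field_simps)
  ultimately show ?thesis using 0 by (simp add: inner_res_def bethe_monom_def)
qed

section \<open>Sums over the Bethe roots are Laurent polynomials\<close>

definition bethe_poly :: "complex \<Rightarrow> complex \<Rightarrow> complex" where
  "bethe_poly z w = w ^ N * (w + 1) ^ (L - N) - z ^ L * (1 + of_real p * w) ^ N"

lemma bethe_roots_eq: "bethe_roots N L p z = {w. bethe_poly z w = 0}"
  by (simp add: bethe_roots_def bethe_poly_def)

lemma bethe_poly_special_nonzero:
  assumes "z \<noteq> 0"
  shows "bethe_poly z 0 \<noteq> 0" "bethe_poly z (-1) \<noteq> 0" "bethe_poly z pole \<noteq> 0"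
proof -
  have "complex_of_real p \<noteq> 1" using p_less by simp
  then show "bethe_poly z 0 \<noteq> 0" "bethe_poly z (-1) \<noteq> 0"
    using assms N_pos N_less by (auto simp: bethe_poly_def power_0_left)
  have "1 + of_real p * pole = 0" using linear_factor_eq_0_iff by simp
  moreover have "pole + 1 \<noteq> 0" using pole_neq(2) by (metis add_eq_0_iff2)
  ultimately show "bethe_poly z pole \<noteq> 0"
    using N_pos pole_neq(1) by (simp add: bethe_poly_def power_0_left)
qed

lemma bethe_root_regular:
  assumes "z \<noteq> 0" "w \<in> bethe_roots N L p z"
  shows "w \<notin> {0, -1, pole}"
  using bethe_poly_special_nonzero[OF assms(1)] assms(2) by (auto simp: bethe_roots_eq)

lemma finite_bethe_roots:
  assumes "z \<noteq> 0"
  shows "finite (bethe_roots N L p z)"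
proof -
  define q where "q = [:0, 1:] ^ N * [:1, 1:] ^ (L - N) - Polynomial.smult (z ^ L) ([:1, complex_of_real p:] ^ N)"
  have q: "poly q w = bethe_poly z w" for w
    by (simp add: q_def bethe_poly_def algebra_simps)
  then have "q \<noteq> 0" using bethe_poly_special_nonzero(1)[OF assms] by (metis poly_0)
  then show ?thesis using poly_roots_finite[of q] q by (simp add: bethe_roots_eq)
qed

definition bethe_residue :: "complex \<Rightarrow> int \<Rightarrow> int \<Rightarrow> int \<Rightarrow> complex" where
  "bethe_residue z a b c =
     residue (\<lambda>w. bethe_monom a b c w / bethe_poly z w) 0 + residue (\<lambda>w. bethe_monom a b c w / bethe_poly z w) (-1)"

lemma bethe_poly_holomorphic [holomorphic_intros]: "bethe_poly z holomorphic_on A"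
  unfolding bethe_poly_def by (intro holomorphic_intros)

lemma bethe_poly_bethe_monom:
  assumes "w \<notin> {0, -1, pole}"
  shows "bethe_poly z w = bethe_monom N (int L - int N) 0 w - z ^ L * bethe_monom 0 0 N w"
  using N_less by (simp add: bethe_poly_def bethe_monom_def power_int_def nat_diff_distrib)

text \<open>
  One step of the geometric sum: the Bethe polynomial is \<open>w ^ N * (w + 1) ^ (L - N) - z ^ L * (1 + p w) ^ N\<close>,
  so the two quotients on the left differ by a plain monomial.
\<close>

lemma bethe_residue_diff:
  fixes a b c :: int
  assumes "z \<noteq> 0"
  shows "bethe_residue z (a + N) (b + (int L - int N)) c - z ^ L * bethe_residue z a b (c + N) = inner_res a b c"
proof -
  have "residue (\<lambda>w. bethe_monom (a + N) (b + (int L - int N)) c w / bethe_poly z w) s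
          - z ^ L * residue (\<lambda>w. bethe_monom a b (c + N) w / bethe_poly z w) s = residue (bethe_monom a b c) s"
    if s: "s \<in> {0, -1}" for s
  proof -
    define A where "A = - ({0, -1, pole} \<union> bethe_roots N L p z - {s})"
    have A: "open A" "s \<in> A"
      unfolding A_def using finite_bethe_roots[OF assms]
      by (intro open_Compl finite_imp_closed finite_Diff; simp) simp
    have s': "bethe_poly z s \<noteq> 0" using s bethe_poly_special_nonzero[OF assms] by auto
    have nz: "bethe_poly z w \<noteq> 0" if "w \<in> A" for w
      using that s' by (auto simp: A_def bethe_roots_eq)
    have hol: "(\<lambda>w. bethe_monom a b c w / bethe_poly z w) holomorphic_on A - {s}" for a b c
      using nz by (intro holomorphic_intros bethe_monom_holomorphic) (auto simp: A_def)
    have "residue (\<lambda>w. bethe_monom (a + N) (b + (int L - int N)) c w / bethe_poly z w) s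
          - z ^ L * residue (\<lambda>w. bethe_monom a b (c + N) w / bethe_poly z w) s
        = residue (\<lambda>w. bethe_monom (a + N) (b + (int L - int N)) c w / bethe_poly z w
            - z ^ L * (bethe_monom a b (c + N) w / bethe_poly z w)) s"
      using residue_diff[OF A hol holomorphic_on_mult[OF holomorphic_on_const hol]] residue_lmul[OF A hol] by simp
    also have "\<dots> = residue (bethe_monom a b c) s"
    proof (rule residue_cong_nhd[OF A])
      fix w assume w: "w \<in> A - {s}"
      then have w': "w \<notin> {0, -1, pole}" by (auto simp: A_def)
      have factor: "bethe_monom (a + N) (b + (int L - int N)) c w = bethe_monom a b c w * bethe_monom N (int L - int N) 0 w"
           "bethe_monom a b (c + N) w = bethe_monom a b c w * bethe_monom 0 0 N w"
        using bethe_monom_mult[OF w'] by simp_all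
      show "bethe_monom (a + N) (b + (int L - int N)) c w / bethe_poly z w
            - z ^ L * (bethe_monom a b (c + N) w / bethe_poly z w) = bethe_monom a b c w"
      proof -
        have "x * u / q - z ^ L * (x * v / q) = x * (u - z ^ L * v) / q" for x u v q :: complex
          by (simp add: diff_divide_distrib algebra_simps)
        then show ?thesis
          using factor nz[of w] w bethe_poly_bethe_monom[OF w', of z] by simp
      qed
    qed
    finally show ?thesis .
  qed
  from this[of 0] this[of "-1"] show ?thesis
    by (simp add: bethe_residue_def inner_res_def algebra_simps)
qed

lemma bethe_residue_eq_0:
  assumes "z \<noteq> 0" "a \<ge> 0" "b \<ge> 0"
  shows "bethe_residue z a b c = 0"
proof -
  have "residue (\<lambda>w. bethe_monom a b c w / bethe_poly z w) s = 0" if "s \<in> {0, -1}" for s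
  proof (rule residue_holo)
    show "open (- (insert pole (bethe_roots N L p z)))"
      using finite_bethe_roots[OF assms(1)] by (auto intro!: finite_imp_closed open_Compl)
    show "s \<in> - (insert pole (bethe_roots N L p z))"
      using that pole_neq bethe_poly_special_nonzero[OF assms(1)] by (auto simp: bethe_roots_eq)
    show "(\<lambda>w. bethe_monom a b c w / bethe_poly z w) holomorphic_on - (insert pole (bethe_roots N L p z))"
      using assms by (intro holomorphic_intros bethe_monom_holomorphic) (auto simp: bethe_roots_eq)
  qed
  then show ?thesis by (simp add: bethe_residue_def)
qed

text \<open>If nothing is left at \<open>-1/p\<close> and at infinity, the residues at \<open>0\<close>, at \<open>-1\<close> and at the roots cancel.\<close>

lemma bethe_residue_infinity:
  fixes a b c :: int
  assumes z: "z \<noteq> 0" and c: "c \<ge> 0" and deg: "a + b + c \<le> int L - 2"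
  shows "bethe_residue z a b c = - (\<Sum>w\<in>bethe_roots N L p z. residue (\<lambda>w. bethe_monom a b c w / bethe_poly z w) w)"
proof -
  let ?f = "\<lambda>w. bethe_monom a b c w / bethe_poly z w"
  let ?S = "bethe_roots N L p z"
  have "(\<Sum>s\<in>{0, -1} \<union> ?S. residue ?f s) = 0"
  proof (rule sum_residues_eq_0)
    show "finite ({0, -1} \<union> ?S)" using finite_bethe_roots[OF z] by simp
    show "?f holomorphic_on - ({0, -1} \<union> ?S)"
      using c by (intro holomorphic_intros bethe_monom_holomorphic) (auto simp: bethe_roots_eq)
    have lim1: "(bethe_monom (a + 1 - N) (b - (int L - int N)) c \<longlongrightarrow> 0) at_infinity"
      using deg by (intro bethe_monom_tendsto_0) auto
    have lim2: "(bethe_monom (- int N) (int N - int L) N \<longlongrightarrow> 0) at_infinity"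
      using N_less by (intro bethe_monom_tendsto_0) auto
    have "((\<lambda>w. bethe_monom (a + 1 - N) (b - (int L - int N)) c w / (1 - z ^ L * bethe_monom (- int N) (int N - int L) N w))
        \<longlongrightarrow> 0 / (1 - z ^ L * 0)) at_infinity"
      by (intro tendsto_divide tendsto_diff tendsto_mult tendsto_const lim1 lim2) simp
    then have lim: "((\<lambda>w. bethe_monom (a + 1 - N) (b - (int L - int N)) c w
        / (1 - z ^ L * bethe_monom (- int N) (int N - int L) N w)) \<longlongrightarrow> 0) at_infinity" by simp
    have "\<forall>\<^sub>F w in at_infinity. w \<notin> {0, -1, pole}"
      using eventually_not_equal_at_infinity[of 0] eventually_not_equal_at_infinity[of "-1"]
        eventually_not_equal_at_infinity[of pole]
      by eventually_elim auto
    then have "\<forall>\<^sub>F w in at_infinity. bethe_monom (a + 1 - N) (b - (int L - int N)) c w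
        / (1 - z ^ L * bethe_monom (- int N) (int N - int L) N w) = w * ?f w"
    proof eventually_elim
      case (elim w)
      have W: "bethe_monom N (int L - int N) 0 w \<noteq> 0" using bethe_monom_nonzero[OF elim] .
      have "bethe_monom (a + 1 - N) (b - (int L - int N)) c w * bethe_monom N (int L - int N) 0 w = bethe_monom (a + 1) b c w"
        using bethe_monom_mult[OF elim] by simp
      also have "\<dots> = w * bethe_monom a b c w"
      proof -
        have "bethe_monom 1 0 0 w = w" by (simp add: bethe_monom_def)
        then show ?thesis using bethe_monom_mult[OF elim, of 1 0 0 a b c] by (simp add: add.commute)
      qed
      finally have 1: "bethe_monom (a + 1 - N) (b - (int L - int N)) c w * bethe_monom N (int L - int N) 0 w = w * bethe_monom a b c w" .
      have "(1 - z ^ L * bethe_monom (- int N) (int N - int L) N w) * bethe_monom N (int L - int N) 0 w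
          = bethe_monom N (int L - int N) 0 w - z ^ L * (bethe_monom (- int N) (int N - int L) N w * bethe_monom N (int L - int N) 0 w)"
        by (simp add: algebra_simps)
      also have "bethe_monom (- int N) (int N - int L) N w * bethe_monom N (int L - int N) 0 w = bethe_monom 0 0 N w"
        using bethe_monom_mult[OF elim] by simp
      finally have 2: "(1 - z ^ L * bethe_monom (- int N) (int N - int L) N w) * bethe_monom N (int L - int N) 0 w = bethe_poly z w"
        using bethe_poly_bethe_monom[OF elim] by simp
      show ?case
        using W 1 2 by (metis mult_divide_mult_cancel_right times_divide_eq_right)
    qed
    then show "((\<lambda>w. w * ?f w) \<longlongrightarrow> 0) at_infinity"
      by (rule Lim_transform_eventually[OF lim])
  qed
  moreover have "(\<Sum>s\<in>{0, -1} \<union> ?S. residue ?f s) = (\<Sum>s\<in>{0, -1}. residue ?f s) + (\<Sum>s\<in>?S. residue ?f s)"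
    using finite_bethe_roots[OF z] bethe_root_regular[OF z] by (intro sum.union_disjoint) auto
  ultimately show ?thesis by (simp add: bethe_residue_def eq_neg_iff_add_eq_0)
qed

definition J_denom :: "complex \<Rightarrow> complex" where
  "J_denom w = of_nat N + of_nat L * w + of_real p * of_nat (L - N) * w ^ 2"

text \<open>
  With \<open>W = w ^ N * (w + 1) ^ (L - N)\<close>, the root equation turns
  the derivative of the Bethe polynomial into \<open>W / J w\<close>.
\<close>

lemma residue_bethe_root:
  fixes a b c :: int
  assumes z: "z \<noteq> 0" and w: "w \<in> bethe_roots N L p z" and simple: "J_denom w \<noteq> 0"
  shows "residue (\<lambda>w. bethe_monom a b c w / bethe_poly z w) w
           = bethe_monom (a - N) (b - (int L - int N)) c w * J_fun N L p w"
proof -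
  note w' = bethe_root_regular[OF z w]
  note nz = factors_nonzero[OF w']
  define A where "A = - ({0, -1, pole} \<union> bethe_roots N L p z - {w})"
  have A: "open A" "w \<in> A"
    unfolding A_def using finite_bethe_roots[OF z]
    by (intro open_Compl finite_imp_closed finite_Diff; simp) simp
  have hol: "(\<lambda>w. bethe_monom a b c w / bethe_poly z w) holomorphic_on A - {w}"
    by (intro holomorphic_intros bethe_monom_holomorphic) (auto simp: A_def bethe_roots_eq)
  define Q' where "Q' = of_nat N * w ^ (N - 1) * (w + 1) ^ (L - N)
      + w ^ N * (of_nat (L - N) * (w + 1) ^ (L - N - 1))
      - z ^ L * (of_nat N * (1 + of_real p * w) ^ (N - 1) * of_real p)"
  have deriv: "(bethe_poly z has_field_derivative Q') (at w)"
    unfolding bethe_poly_def Q'_def by (auto intro!: derivative_eq_intros)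
  define W where "W = w ^ N * (w + 1) ^ (L - N)"
  have root: "z ^ L * (1 + of_real p * w) ^ N = W"
    using w by (simp add: bethe_roots_eq bethe_poly_def W_def)
  have pw: "x * x ^ (n - 1) = x ^ n" if "n \<ge> 1" for x :: complex and n
    using that by (metis One_nat_def Suc_le_D diff_Suc_1 power_Suc)
  have "w * (w + 1) * (1 + of_real p * w) * Q'
      = (of_nat N * (w + 1) * (1 + of_real p * w)) * ((w * w ^ (N - 1)) * (w + 1) ^ (L - N))
      + (of_nat (L - N) * w * (1 + of_real p * w)) * (w ^ N * ((w + 1) * (w + 1) ^ (L - N - 1)))
      - (of_nat N * of_real p * w * (w + 1)) * (z ^ L * ((1 + of_real p * w) * (1 + of_real p * w) ^ (N - 1)))"
  proof -
    have "w * (w + 1) * q * (n * x1 * x2 + x3 * (k * x4) - zl * (n * x5 * r))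
        = (n * (w + 1) * q) * ((w * x1) * x2) + (k * w * q) * (x3 * ((w + 1) * x4))
          - (n * r * w * (w + 1)) * (zl * (q * x5))" for q n x1 x2 x3 k x4 zl x5 r :: complex
      by (simp add: algebra_simps)
    then show ?thesis unfolding Q'_def .
  qed
  also have "\<dots> = (of_nat N * (w + 1) * (1 + of_real p * w)) * W
      + (of_nat (L - N) * w * (1 + of_real p * w)) * W
      - (of_nat N * of_real p * w * (w + 1)) * W"
  proof -
    have "w * w ^ (N - 1) = w ^ N" "(w + 1) * (w + 1) ^ (L - N - 1) = (w + 1) ^ (L - N)"
      "(1 + of_real p * w) * (1 + of_real p * w) ^ (N - 1) = (1 + of_real p * w) ^ N"
      using N_pos N_less by (intro pw; simp)+
    then show ?thesis by (simp only: root W_def[symmetric])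
  qed
  also have "\<dots> = W * J_denom w"
    using N_less by (simp add: J_denom_def of_nat_diff algebra_simps power2_eq_square)
  finally have Q'_eq: "w * (w + 1) * (1 + of_real p * w) * Q' = W * J_denom w" .
  have W: "W \<noteq> 0" "W = bethe_monom N (int L - int N) 0 w"
    using nz N_less by (simp_all add: W_def bethe_monom_def power_int_def nat_diff_distrib)
  have Q'0: "Q' \<noteq> 0" using Q'_eq W simple nz by auto
  have "((\<lambda>v. (bethe_poly z v - bethe_poly z w) / (v - w)) \<longlongrightarrow> Q') (at w)"
    using deriv by (simp add: has_field_derivative_iff)
  then have "((\<lambda>v. bethe_poly z v / (v - w)) \<longlongrightarrow> Q') (at w)"
    using w by (simp add: bethe_roots_eq)
  moreover have "(bethe_monom a b c \<longlongrightarrow> bethe_monom a b c w) (at w)"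
  proof -
    have "bethe_monom a b c holomorphic_on - {0, -1, pole}" by (intro bethe_monom_holomorphic) auto
    then have "continuous_on (- {0, -1, pole}) (bethe_monom a b c)" by (rule holomorphic_on_imp_continuous_on)
    then have "isCont (bethe_monom a b c) w"
      using w' by (subst (asm) continuous_on_eq_continuous_at) (auto intro!: finite_imp_closed open_Compl)
    then show ?thesis by (rule isContD)
  qed
  ultimately have "((\<lambda>v. bethe_monom a b c v / (bethe_poly z v / (v - w))) \<longlongrightarrow> bethe_monom a b c w / Q') (at w)"
    using Q'0 by (intro tendsto_divide)
  then have "((\<lambda>v. bethe_monom a b c v / bethe_poly z v * (v - w)) \<longlongrightarrow> bethe_monom a b c w / Q') (at w)"
    by simp
  then have "residue (\<lambda>w. bethe_monom a b c w / bethe_poly z w) w = bethe_monom a b c w / Q'"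
    by (intro residue_simple'[OF A hol])
  also have "bethe_monom a b c w / Q' = (bethe_monom a b c w / W) * J_fun N L p w"
  proof -
    have J: "J_fun N L p w = w * (w + 1) * (1 + of_real p * w) / J_denom w"
      by (simp add: J_fun_def J_denom_def)
    have "1 / Q' = J_fun N L p w / W"
      unfolding J using Q'_eq W Q'0 simple by (simp add: field_simps)
    then show ?thesis by (metis mult.commute mult.right_neutral times_divide_eq_left times_divide_eq_right)
  qed
  also have "bethe_monom a b c w / W = bethe_monom (a - N) (b - (int L - int N)) c w"
    using bethe_monom_mult[OF w', of "a - N" "b - (int L - int N)" c N "int L - int N" 0] W
    by (simp add: field_simps)
  finally show ?thesis .
qed

text \<open>
  With \<open>\<rho> = z ^ L * (1 + p w) ^ N / (w ^ N * (w + 1) ^ (L - N))\<close>, multiplying by \<open>\<rho> ^ m\<close> does not change a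
  function on the Bethe roots; this is the residue sum that remains of the monomial after it.
\<close>

definition laurent_term :: "complex \<Rightarrow> int \<Rightarrow> int \<Rightarrow> int \<Rightarrow> int \<Rightarrow> complex" where
  "laurent_term z a b c m =
     z powi (int L * m) * inner_res (a - m * int N) (b - m * (int L - int N)) (c + m * int N)"

definition root_trace :: "complex \<Rightarrow> int \<Rightarrow> int \<Rightarrow> int \<Rightarrow> complex" where
  "root_trace z a b c = Sum_any (laurent_term z a b c)"

text \<open>
  For very negative \<open>m\<close> the shifted monomial has no pole at \<open>0\<close> and \<open>-1\<close>; for very positive \<open>m\<close> it
  has none at \<open>-1/p\<close>, and since \<open>N < L\<close> its total degree falls below \<open>-1\<close>.
\<close>

lemma inner_res_shift_support:
  assumes K: "\<bar>a\<bar> + \<bar>b\<bar> + \<bar>c\<bar> + 2 \<le> K" and m: "m \<notin> {- K..<K}"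
  shows "inner_res (a - m * int N) (b - m * (int L - int N)) (c + m * int N) = 0"
proof (cases "m < - K")
  case True
  have "- m * 1 \<le> - m * int N" "- m * 1 \<le> - m * (int L - int N)"
    using True K N_pos N_less by (intro mult_left_mono; simp)+
  then show ?thesis using True K by (intro inner_res_eq_0_nonneg) auto
next
  case False
  have "m * 1 \<le> m * int N" "m * 1 \<le> m * (int L - int N)"
    using False m K N_pos N_less by (intro mult_left_mono; simp)+
  then show ?thesis using False m K by (intro inner_res_eq_0_infinity) (auto simp: algebra_simps)
qed

lemma laurent_term_eq_0:
  assumes "\<bar>a\<bar> + \<bar>b\<bar> + \<bar>c\<bar> + 2 \<le> K" "m \<notin> {- K..<K}"
  shows "laurent_term z a b c m = 0"
  unfolding laurent_term_def inner_res_shift_support[OF assms] by simp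

lemma root_trace_finite_sum:
  assumes "\<bar>a\<bar> + \<bar>b\<bar> + \<bar>c\<bar> + 2 \<le> K"
  shows "root_trace z a b c = (\<Sum>m\<in>{- K..<K}. laurent_term z a b c m)"
  unfolding root_trace_def using laurent_term_eq_0[OF assms]
  by (intro Sum_any.expand_superset) blast+

lemma finite_laurent_support: "finite {m. laurent_term z a b c m \<noteq> 0}"
  by (rule finite_subset[of _ "{- (\<bar>a\<bar> + \<bar>b\<bar> + \<bar>c\<bar> + 2)..<\<bar>a\<bar> + \<bar>b\<bar> + \<bar>c\<bar> + 2}"])
    (use laurent_term_eq_0[OF order.refl] in blast, simp)

lemma root_trace_holomorphic:
  assumes "0 \<notin> A"
  shows "(\<lambda>z. root_trace z a b c) holomorphic_on A"
  unfolding root_trace_finite_sum[OF order.refl] laurent_term_def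
  using assms by (auto intro!: holomorphic_intros)

text \<open>
  The terms of the Laurent polynomial telescope by \<open>bethe_residue_diff\<close>. The lower end of the telescoping sum vanishes
  because there are no poles at \<open>0\<close> and \<open>-1\<close>; the upper end is the sum of the residues at the roots,
  where the accumulated power of \<open>\<rho>\<close> equals \<open>1\<close>.
\<close>

theorem sum_bethe_roots_eq_root_trace:
  fixes a b c :: int
  assumes z: "z \<noteq> 0" and simple: "\<And>w. w \<in> bethe_roots N L p z \<Longrightarrow> J_denom w \<noteq> 0"
  shows "(\<Sum>w\<in>bethe_roots N L p z. bethe_monom a b c w * J_fun N L p w) = root_trace z a b c"
proof -
  define K where "K = nat (\<bar>a\<bar> + \<bar>b\<bar> + \<bar>c\<bar> + 2)"
  have K: "\<bar>a\<bar> + \<bar>b\<bar> + \<bar>c\<bar> + 2 = int K" by (simp add: K_def)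
  \<comment> \<open>the telescoping quantity, the residue of \<open>W * f * \<rho> ^ m\<close> over the Bethe polynomial\<close>
  define B where "B m = z powi (int L * m)
    * bethe_residue z (a - m * N + N) (b - m * (int L - int N) + (int L - int N)) (c + m * N)" for m
  have KN: "int K * 1 \<le> int K * int N" "int K * 1 \<le> int K * (int L - int N)"
    using N_pos N_less by (intro mult_left_mono; simp)+
  have step: "laurent_term z a b c m = B m - B (m + 1)" for m
  proof -
    have "a - (m + 1) * N + N = a - m * N" "b - (m + 1) * (int L - int N) + (int L - int N) = b - m * (int L - int N)"
      "c + (m + 1) * N = c + m * N + N" "z powi (int L * (m + 1)) = z powi (int L * m) * z ^ L"
      using z by (simp_all add: algebra_simps power_int_add)
    then have "B m - B (m + 1) = z powi (int L * m) * (bethe_residue z (a - m * N + N) (b - m * (int L - int N) + (int L - int N)) (c + m * N)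
        - z ^ L * bethe_residue z (a - m * N) (b - m * (int L - int N)) (c + m * N + N))"
      by (simp only: B_def) (simp add: algebra_simps)
    also have "\<dots> = laurent_term z a b c m"
      using bethe_residue_diff[OF z, of "a - m * N" "b - m * (int L - int N)" "c + m * N"]
      by (simp add: laurent_term_def)
    finally show ?thesis by simp
  qed
  have "root_trace z a b c = (\<Sum>m\<in>{- int K..<int K}. B m - B (m + 1))"
    by (simp add: root_trace_finite_sum[OF K[THEN eq_refl]] step)
  also have "\<dots> = B (- int K) - B (int K)" by (rule sum_telescope_int)
  also have "B (- int K) = 0"
    using KN K N_less unfolding B_def by (subst bethe_residue_eq_0[OF z]) (auto simp: algebra_simps)
  also have "B (int K) = - (z powi (int L * int K)
      * (\<Sum>w\<in>bethe_roots N L p z. bethe_monom (a - K * N) (b - K * (int L - int N)) (c + K * N) w * J_fun N L p w))"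
  proof -
    have "B (int K) = z powi (int L * int K) * - (\<Sum>w\<in>bethe_roots N L p z. residue (\<lambda>w.
        bethe_monom (a - K * N + N) (b - K * (int L - int N) + (int L - int N)) (c + K * N) w / bethe_poly z w) w)"
      unfolding B_def using KN K by (subst bethe_residue_infinity[OF z]) (auto simp: algebra_simps)
    also have "(\<Sum>w\<in>bethe_roots N L p z. residue (\<lambda>w.
        bethe_monom (a - K * N + N) (b - K * (int L - int N) + (int L - int N)) (c + K * N) w / bethe_poly z w) w)
      = (\<Sum>w\<in>bethe_roots N L p z. bethe_monom (a - K * N) (b - K * (int L - int N)) (c + K * N) w * J_fun N L p w)"
      by (intro sum.cong refl, subst residue_bethe_root[OF z _ simple]) simp_all
    finally show ?thesis by simp
  qed
  also have "0 - - (z powi (int L * int K)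
      * (\<Sum>w\<in>bethe_roots N L p z. bethe_monom (a - K * N) (b - K * (int L - int N)) (c + K * N) w * J_fun N L p w))
    = (\<Sum>w\<in>bethe_roots N L p z. z powi (int L * int K) * bethe_monom (a - K * N) (b - K * (int L - int N)) (c + K * N) w * J_fun N L p w)"
    by (simp add: sum_distrib_left mult_ac)
  also have "\<dots> = (\<Sum>w\<in>bethe_roots N L p z. bethe_monom a b c w * J_fun N L p w)"
  proof (intro sum.cong refl)
    fix w assume w: "w \<in> bethe_roots N L p z"
    note w' = bethe_root_regular[OF z w]
    note nz = factors_nonzero[OF w']
    have "bethe_monom N (int L - int N) 0 w = z ^ L * bethe_monom 0 0 N w"
      using w bethe_poly_bethe_monom[OF w', of z] by (simp add: bethe_roots_eq)
    then have "z ^ L = bethe_monom N (int L - int N) 0 w * bethe_monom 0 0 (- int N) w"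
      using bethe_monom_mult[OF w', of 0 0 N 0 0 "- int N"] by (simp add: mult.assoc) (simp add: bethe_monom_def)
    also have "\<dots> = bethe_monom N (int L - int N) (- int N) w" using bethe_monom_mult[OF w'] by simp
    finally have "z powi (int L * int K) = bethe_monom N (int L - int N) (- int N) w powi int K"
      by (simp add: power_int_mult)
    also have "\<dots> = bethe_monom (K * N) (K * (int L - int N)) (- (K * int N)) w"
      unfolding bethe_monom_def power_int_mult_distrib
      by (simp only: power_int_mult[symmetric] mult.commute[of _ "int K"] of_nat_mult mult_minus_right)
    finally show "z powi (int L * int K) * bethe_monom (a - K * N) (b - K * (int L - int N)) (c + K * N) w * J_fun N L p w
        = bethe_monom a b c w * J_fun N L p w"
      using bethe_monom_mult[OF w'] by simp
  qed
  finally show ?thesis by simp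
qed

text \<open>
  A multiple root is one of at most two zeros of the denominator of \<open>J\<close>, and each of them is a root
  for at most \<open>L\<close> values of \<open>z\<close>.
\<close>

lemma finite_multiple_root_parameters:
  "finite {z. \<exists>w \<in> bethe_roots N L p z. J_denom w = 0}"
proof -
  define D where "D = [:of_nat N, of_nat L, complex_of_real p * of_nat (L - N):]"
  have D: "poly D w = J_denom w" for w
    by (simp add: D_def J_denom_def power2_eq_square algebra_simps)
  have "D \<noteq> 0" using N_pos by (auto simp: D_def)
  then have fin: "finite {w. J_denom w = 0}" using poly_roots_finite[of D] D by simp
  have "finite {z. w \<in> bethe_roots N L p z}" for w
  proof (cases "(1 + of_real p * w) ^ N = 0")
    case True
    then have w: "w = pole" using linear_factor_eq_0_iff by auto
    have eq: "bethe_poly z w = w ^ N * (w + 1) ^ (L - N)" for z unfolding bethe_poly_def True by simp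
    have "bethe_poly 1 w \<noteq> 0" using bethe_poly_special_nonzero[of 1] w by simp
    then have "bethe_poly z w \<noteq> 0" for z using eq by metis
    then have "{z. w \<in> bethe_roots N L p z} = {}" by (simp add: bethe_roots_eq)
    then show ?thesis by simp
  next
    case False
    then have "{z. w \<in> bethe_roots N L p z} \<subseteq> {z. z ^ L = w ^ N * (w + 1) ^ (L - N) / (1 + of_real p * w) ^ N}"
      by (auto simp: bethe_roots_eq bethe_poly_def field_simps)
    then show ?thesis using finite_nth_roots[of L] N_less finite_subset by blast
  qed
  then have "finite (\<Union>w\<in>{w. J_denom w = 0}. {z. w \<in> bethe_roots N L p z})" using fin by blast
  then show ?thesis by (rule finite_subset[rotated]) auto
qed

theorem remove_sings_sum_bethe_roots:
  assumes z: "z \<noteq> 0"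
  shows "remove_sings (\<lambda>z. \<Sum>w\<in>bethe_roots N L p z. bethe_monom a b c w * J_fun N L p w) z = root_trace z a b c"
proof (rule remove_sings_eqI)
  let ?X = "insert 0 {z. \<exists>w \<in> bethe_roots N L p z. J_denom w = 0}"
  have "open (- (?X - {z}))" using finite_multiple_root_parameters
    by (intro open_Compl finite_imp_closed) auto
  then have "\<forall>\<^sub>F z' in nhds z. z' \<in> - (?X - {z})" by (rule eventually_nhds_in_open) simp
  then have "\<forall>\<^sub>F z' in at z. z' \<notin> ?X" unfolding eventually_at_filter by eventually_elim auto
  then have ev: "\<forall>\<^sub>F z' in at z. root_trace z' a b c
      = (\<Sum>w\<in>bethe_roots N L p z'. bethe_monom a b c w * J_fun N L p w)"
    by eventually_elim (subst sum_bethe_roots_eq_root_trace; auto)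
  have "continuous_on (- {0}) (\<lambda>z. root_trace z a b c)"
    by (intro holomorphic_on_imp_continuous_on root_trace_holomorphic) simp
  then have "isCont (\<lambda>z. root_trace z a b c) z"
    using z by (subst (asm) continuous_on_eq_continuous_at) auto
  then show "(\<lambda>z. \<Sum>w\<in>bethe_roots N L p z. bethe_monom a b c w * J_fun N L p w) \<midarrow>z\<rightarrow> root_trace z a b c"
    by (intro Lim_transform_eventually[OF isContD ev])
qed

lemma root_sum_eq_root_trace:
  assumes "z \<noteq> 0"
  shows "root_sum N L p i j x y t z =
    root_trace z (int j - int i) (- x (N - i + 1) + y (N - j + 1) + int i - int j - 1) (int t + int i - int j)"
  unfolding remove_sings_sum_bethe_roots[OF assms, symmetric] root_sum_def F_fun_def bethe_monom_def ..

lemma root_trace_pole_factor: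
  "root_trace z a b c = root_trace z a b (c - 1) + of_real p * root_trace z (a + 1) b (c - 1)"
proof -
  have "laurent_term z a b c m = laurent_term z a b (c - 1) m + of_real p * laurent_term z (a + 1) b (c - 1) m" for m
    unfolding laurent_term_def
    by (subst inner_res_pole_factor) (simp add: algebra_simps)
  then have "root_trace z a b c
      = Sum_any (\<lambda>m. laurent_term z a b (c - 1) m + of_real p * laurent_term z (a + 1) b (c - 1) m)"
    unfolding root_trace_def by simp
  also have "\<dots> = root_trace z a b (c - 1) + of_real p * root_trace z (a + 1) b (c - 1)"
    unfolding root_trace_def Sum_any_right_distrib[OF finite_laurent_support]
    by (rule Sum_any.distrib) (use finite_laurent_support p_pos in auto)
  finally show ?thesis .
qed

lemma root_trace_hop:
  "root_trace z a b (c + 1) = (1 - of_real p) * root_trace z a b c + of_real p * root_trace z a (b + 1) c"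
proof -
  have "laurent_term z a b (c + 1) m = (1 - of_real p) * laurent_term z a b c m + of_real p * laurent_term z a (b + 1) c m" for m
    unfolding laurent_term_def
    using inner_res_hop[of "a - m * N" "b - m * (int L - int N)" "c + m * N"]
    by (simp add: distrib_left diff_conv_add_uminus add_ac mult.left_commute del: add_uminus_conv_diff)
  then have "root_trace z a b (c + 1)
      = Sum_any (\<lambda>m. (1 - of_real p) * laurent_term z a b c m + of_real p * laurent_term z a (b + 1) c m)"
    unfolding root_trace_def by simp
  also have "\<dots> = (1 - of_real p) * root_trace z a b c + of_real p * root_trace z a (b + 1) c"
    unfolding root_trace_def Sum_any_right_distrib[OF finite_laurent_support]
    by (rule Sum_any.distrib) (rule finite_subset[OF _ finite_laurent_support]; auto)+
  finally show ?thesis .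
qed

text \<open>
  The root equation in terms of the Laurent polynomial. It makes row \<open>i + N\<close> of the periodically
  continued particle system a multiple of row \<open>i\<close>.
\<close>

lemma root_trace_shift:
  fixes a b c :: int
  assumes "z \<noteq> 0"
  shows "root_trace z (a - N) (b - (int L - int N)) (c + N) = z powi (- int L) * root_trace z a b c"
proof -
  have "Sum_any (laurent_term z (a - N) (b - (int L - int N)) (c + N))
      = Sum_any (\<lambda>m. z powi (- int L) * laurent_term z a b c m)"
  proof (rule Sum_any.reindex_cong[where l = "\<lambda>m. m - 1"])
    show "bij (\<lambda>m::int. m - 1)" by (rule bij_betwI[where g = "\<lambda>m. m + 1"]) auto
    show "laurent_term z (a - N) (b - (int L - int N)) (c + N) \<circ> (\<lambda>m. m - 1)
        = (\<lambda>m. z powi (- int L) * laurent_term z a b c m)"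
    proof
      fix m
      have e1: "z powi (int L * (m - 1)) = z powi (- int L) * z powi (int L * m)"
        using assms by (simp add: algebra_simps flip: power_int_add)
      have e2: "a - int N - (m - 1) * int N = a - m * int N" "c + int N + (m - 1) * int N = c + m * int N"
        "b - (int L - int N) - (m - 1) * (int L - int N) = b - m * (int L - int N)"
        by (simp_all add: algebra_simps)
      show "(laurent_term z (a - N) (b - (int L - int N)) (c + N) \<circ> (\<lambda>m. m - 1)) m
          = z powi (- int L) * laurent_term z a b c m"
        unfolding o_def laurent_term_def e1 e2 by simp
    qed
  qed
  then show ?thesis
    unfolding root_trace_def Sum_any_right_distrib[OF finite_laurent_support] .
qed

section \<open>Configurations and one step of the dynamics\<close>

abbreviation gap :: "(nat \<Rightarrow> int) \<Rightarrow> nat \<Rightarrow> int" where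
  "gap x i \<equiv> right_nbr N L x i - x i"

definition ahead :: "nat \<Rightarrow> nat" where
  "ahead i = (if i = 1 then N else i - 1)"

definition behind :: "nat \<Rightarrow> nat" where
  "behind i = (if i = N then 1 else i + 1)"

lemma ahead_behind:
  assumes "i \<in> {1..N}"
  shows "ahead i \<in> {1..N}" "behind i \<in> {1..N}" "ahead (behind i) = i" "behind (ahead i) = i"
  using assms N_pos by (auto simp: ahead_def behind_def)

lemma bij_behind: "bij_betw behind {1..N} {1..N}"
  by (rule bij_betwI[where g = ahead]) (use ahead_behind in auto)

lemma right_nbr_ahead: "right_nbr N L x i = x (ahead i) + (if i = 1 then int L else 0)"
  by (simp add: right_nbr_def ahead_def)

lemma configs_iff:
  "x \<in> configs N L \<longleftrightarrow> x \<in> extensional {1..N} \<and> (\<forall>i\<in>{1..N}. 1 \<le> gap x i)"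
proof
  assume x: "x \<in> configs N L"
  then have anti: "\<And>i j. i \<in> {1..N} \<Longrightarrow> j \<in> {1..N} \<Longrightarrow> i < j \<Longrightarrow> x j < x i"
    and wrap: "x 1 < x N + int L" and ext: "x \<in> extensional {1..N}"
    by (auto simp: configs_def PiE_def monotone_on_def)
  have "1 \<le> gap x i" if "i \<in> {1..N}" for i
  proof (cases "i = 1")
    case False
    then have "x i < x (i - 1)" using that by (intro anti) auto
    then show ?thesis using False by (simp add: right_nbr_def)
  qed (use wrap in \<open>simp add: right_nbr_def\<close>)
  then show "x \<in> extensional {1..N} \<and> (\<forall>i\<in>{1..N}. 1 \<le> gap x i)" using ext by blast
next
  assume x: "x \<in> extensional {1..N} \<and> (\<forall>i\<in>{1..N}. 1 \<le> gap x i)"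
  have anti: "x j < x i" if "i < j" "1 \<le> i" "j \<le> N" for i j
    using that
  proof (induction j rule: less_induct)
    case (less j)
    have "j \<in> {1..N}" "j \<noteq> 1" using less.prems by auto
    then have "1 \<le> x (j - 1) - x j" using x unfolding right_nbr_def by metis
    then have "x j < x (j - 1)" by simp
    moreover have "x (j - 1) \<le> x i"
      using less.IH[of "j - 1"] less.prems by (cases "j - 1 = i") fastforce+
    ultimately show ?case by simp
  qed
  have "x 1 < x N + int L" using x N_pos by (force simp: right_nbr_def)
  then show "x \<in> configs N L" using x anti by (auto simp: configs_def PiE_def monotone_on_def)
qed

text \<open>
  The positions of all particles of the periodic system, numbered by the integers from left to right:
  index \<open>r < N\<close> is particle \<open>N - r\<close>, and \<open>N\<close> further indices advance the position by \<open>L\<close>.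
\<close>

definition lift :: "(nat \<Rightarrow> int) \<Rightarrow> int \<Rightarrow> int" where
  "lift x k = x (N - nat (k mod int N)) + (k div int N) * int L"

lemma lift_of_nat: "r < N \<Longrightarrow> lift x (int r) = x (N - r)"
  by (simp add: lift_def)

lemma lift_shift: "lift x (k + m * int N) = lift x k + m * int L"
  using N_pos by (simp add: lift_def distrib_right)

lemma lift_succ:
  assumes "r < N"
  shows "lift x (int r + 1) = right_nbr N L x (N - r)"
proof (cases "r = N - 1")
  case True
  then have "int r + 1 = 0 + 1 * int N" using assms by simp
  then have "lift x (int r + 1) = lift x (int 0) + 1 * int L" by (simp only: lift_shift of_nat_0)
  then show ?thesis using True assms lift_of_nat[of 0 x] by (simp add: right_nbr_def)
next
  case False
  then have "int r + 1 = int (r + 1)" "r + 1 < N" using assms by auto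
  then have "lift x (int r + 1) = x (N - (r + 1))" by (simp only: lift_of_nat)
  then show ?thesis using False assms by (auto simp: right_nbr_def)
qed

lemma int_window:
  obtains r m where "r < N" "k = int r + m * int N"
proof
  show "nat (k mod int N) < N" using N_pos by (simp add: nat_less_iff)
  show "k = int (nat (k mod int N)) + (k div int N) * int N" using N_pos by simp
qed

lemma lift_step:
  assumes "x \<in> configs N L"
  shows "lift x k + 1 \<le> lift x (k + 1)"
proof -
  obtain r m where r: "r < N" "k = int r + m * int N" using int_window .
  have "lift x k = x (N - r) + m * int L" using lift_shift lift_of_nat r by simp
  moreover have "lift x (k + 1) = lift x (int r + 1) + m * int L"
    using lift_shift[of x "int r + 1" m] r by (simp add: algebra_simps)
  moreover have "1 \<le> gap x (N - r)" using assms r by (auto simp: configs_iff)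
  ultimately show ?thesis using lift_succ[OF r(1)] by simp
qed

text \<open>
  Neighbouring particles are at least one site apart, so subtracting the index from the position leaves a weakly
  increasing sequence, constant exactly along blocks of adjacent particles.
\<close>

lemma lift_mono:
  assumes "x \<in> configs N L" "k \<le> l"
  shows "lift x k - k \<le> lift x l - l"
proof (rule mono_on_int_of_step[OF _ assms(2)])
  fix k show "lift x k - k \<le> lift x (k + 1) - (k + 1)" using lift_step[OF assms(1), of k] by simp
qed

lemma occupied_iff:
  assumes x: "x \<in> configs N L" and i: "i \<in> {1..N}"
  shows "x i + 1 \<in> occupied N L x \<longleftrightarrow> gap x i = 1"
proof
  assume "gap x i = 1"
  then have "x i + 1 = x (ahead i) - (if i = 1 then - 1 else 0) * int L"
    by (auto simp: right_nbr_ahead split: if_splits)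
  then show "x i + 1 \<in> occupied N L x" using ahead_behind[OF i] unfolding occupied_def by blast
next
  assume "x i + 1 \<in> occupied N L x"
  then obtain j k where j: "j \<in> {1..N}" "x i + 1 = x j - k * int L" by (auto simp: occupied_def)
  have "lift x (int (N - j) + (- k) * int N) = x j - k * int L"
    using lift_shift[of x "int (N - j)" "- k"] lift_of_nat[of "N - j" x] j by simp
  then obtain l where l: "lift x l = x i + 1" using j by metis
  have xi: "lift x (int (N - i)) = x i" "right_nbr N L x i = lift x (int (N - i) + 1)"
    using lift_of_nat[of "N - i" x] lift_succ[of "N - i" x] i by simp_all
  have "int (N - i) < l" using lift_mono[OF x, of l "int (N - i)"] l xi by linarith
  then have "lift x (int (N - i) + 1) \<le> x i + 1"
    using lift_mono[OF x, of "int (N - i) + 1" l] l by linarith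
  moreover have "1 \<le> gap x i" using x i by (auto simp: configs_iff)
  ultimately show "gap x i = 1" using xi by simp
qed

lemma pmf_bernoulli_hop:
  "pmf (map_pmf (\<lambda>b. if b then a + 1 else a) (bernoulli_pmf p)) (v :: int)
     = (if v = a + 1 then p else if v = a then 1 - p else 0)"
proof -
  have inj: "inj (\<lambda>b. if b then a + 1 else a)" by (auto simp: inj_def split: if_splits)
  show ?thesis
    using pmf_map_inj'[OF inj, of "bernoulli_pmf p" True] pmf_map_inj'[OF inj, of "bernoulli_pmf p" False]
      pmf_map_outside[of v "\<lambda>b. if b then a + 1 else a" "bernoulli_pmf p"] p_pos p_less
    by (cases "v \<in> {a, a + 1}") (auto split: if_splits)
qed

lemma pmf_tasep_step:
  assumes "x' \<in> configs N L"
  shows "pmf (tasep_step N L p x') x =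
     (if x \<in> extensional {1..N}
      then \<Prod>i\<in>{1..N}. if gap x' i = 1 then of_bool (x i = x' i)
             else if x i = x' i + 1 then p else if x i = x' i then 1 - p else 0
      else 0)"
proof -
  have "pmf (if x' i + 1 \<notin> occupied N L x'
            then map_pmf (\<lambda>b. if b then x' i + 1 else x' i) (bernoulli_pmf p)
            else return_pmf (x' i)) (x i)
      = (if gap x' i = 1 then of_bool (x i = x' i)
             else if x i = x' i + 1 then p else if x i = x' i then 1 - p else 0)"
    if "i \<in> {1..N}" for i
    using occupied_iff[OF assms that] pmf_bernoulli_hop[of "x' i" "x i"] by (auto simp: pmf_return)
  then show ?thesis
    unfolding tasep_step_def by (subst pmf_Pi) (auto simp: extensional_def intro!: prod.cong)
qed

lemma tasep_step_moves:
  assumes x': "x' \<in> configs N L" and nz: "pmf (tasep_step N L p x') x \<noteq> 0"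
  shows "x \<in> extensional {1..N}"
    "i \<in> {1..N} \<Longrightarrow> x i = x' i \<or> x i = x' i + 1 \<and> gap x' i \<noteq> 1"
proof -
  show "x \<in> extensional {1..N}" using nz by (metis pmf_tasep_step[OF x'])
  define q where "q i = (if gap x' i = 1 then of_bool (x i = x' i)
             else if x i = x' i + 1 then p else if x i = x' i then 1 - p else 0)" for i
  have "(\<Prod>i\<in>{1..N}. q i) \<noteq> 0"
    using nz unfolding pmf_tasep_step[OF x'] q_def by presburger
  then have "q i \<noteq> 0" if "i \<in> {1..N}" using that by (metis finite_atLeastAtMost prod_zero)
  then show "x i = x' i \<or> x i = x' i + 1 \<and> gap x' i \<noteq> 1" if "i \<in> {1..N}"
    using that by (auto simp: q_def split: if_splits)
qed

lemma tasep_step_configs: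
  assumes x': "x' \<in> configs N L" and x: "x \<in> set_pmf (tasep_step N L p x')"
  shows "x \<in> configs N L"
proof -
  have nz: "pmf (tasep_step N L p x') x \<noteq> 0" using x by (simp add: set_pmf_iff)
  note ext = tasep_step_moves(1)[OF x' nz] and hop = tasep_step_moves(2)[OF x' nz]
  have "1 \<le> gap x i" if i: "i \<in> {1..N}" for i
  proof -
    have "1 \<le> gap x' i" using x' i by (auto simp: configs_iff)
    moreover have "x' (ahead i) \<le> x (ahead i)" using hop[of "ahead i"] ahead_behind[OF i] by auto
    ultimately show ?thesis using hop[OF i] by (auto simp: right_nbr_ahead)
  qed
  then show ?thesis using ext by (simp add: configs_iff)
qed

lemma tasep_pmf_configs:
  assumes "y \<in> configs N L"
  shows "set_pmf (tasep_pmf N L p t y) \<subseteq> configs N L"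
  by (induction t) (use assms tasep_step_configs in \<open>auto simp: set_bind_pmf\<close>)

text \<open>
  The possible displacements in a step that ends in \<open>x\<close>. If there is now a particle directly behind
  \<open>i\<close>, then \<open>i\<close> did not move: otherwise the particle behind would have been on the same site before the
  step, or it would have been blocked and moved nevertheless.
\<close>

definition hops :: "(nat \<Rightarrow> int) \<Rightarrow> (nat \<Rightarrow> int) set" where
  "hops x = PiE {1..N} (\<lambda>i. if gap x (behind i) = 1 then {0} else {0, 1})"

definition undo :: "(nat \<Rightarrow> int) \<Rightarrow> (nat \<Rightarrow> int) \<Rightarrow> nat \<Rightarrow> int" where
  "undo x e = (\<lambda>i\<in>{1..N}. x i - e i)"

definition hop_weight :: "int \<Rightarrow> real" where
  "hop_weight e = (if e = 1 then p else 1 - p)"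

definition blocking_factor :: "(nat \<Rightarrow> int) \<Rightarrow> real" where
  "blocking_factor x = (\<Prod>i=1..N. 1 - p * of_bool (gap x i = 1))"

lemma blocking_factor_pos: "blocking_factor x > 0"
  unfolding blocking_factor_def using p_less by (intro prod_pos) auto

lemma finite_hops: "finite (hops x)"
  unfolding hops_def by (intro finite_PiE) auto

lemma gap_undo:
  assumes "i \<in> {1..N}"
  shows "gap (undo x e) i = gap x i - e (ahead i) + e i"
  using assms ahead_behind[OF assms] by (simp add: right_nbr_ahead undo_def)

lemma hopsD:
  assumes "e \<in> hops x" "i \<in> {1..N}"
  shows "e i = 0 \<or> e i = 1" "gap x i = 1 \<Longrightarrow> e (ahead i) = 0"
proof -
  show "e i = 0 \<or> e i = 1"
    using PiE_mem[OF assms(1)[unfolded hops_def] assms(2)] by (simp split: if_splits)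
  show "e (ahead i) = 0" if "gap x i = 1"
    using PiE_mem[OF assms(1)[unfolded hops_def] ahead_behind(1)[OF assms(2)]] that
    by (simp add: ahead_behind(4)[OF assms(2)])
qed

lemma undo_configs:
  assumes "x \<in> configs N L" "e \<in> hops x"
  shows "undo x e \<in> configs N L"
proof -
  have "1 \<le> gap (undo x e) i" if i: "i \<in> {1..N}" for i
  proof -
    have "1 \<le> gap x i" using assms(1) i by (auto simp: configs_iff)
    then show ?thesis
      using hopsD[OF assms(2) i] hopsD(1)[OF assms(2) ahead_behind(1)[OF i]] gap_undo[OF i, of x e] by linarith
  qed
  then show ?thesis by (simp add: configs_iff undo_def)
qed

text \<open>
  A blocked particle stays with probability \<open>1\<close>, but contributes a factor \<open>1 - p\<close> to the blocking
  factor of the old configuration. Hence after multiplication with it the weight of a step is that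
  of independent free particles.
\<close>

lemma step_weight:
  assumes x: "x \<in> configs N L" and e: "e \<in> hops x"
  shows "pmf (tasep_step N L p (undo x e)) x * blocking_factor (undo x e) = (\<Prod>i\<in>{1..N}. hop_weight (e i))"
proof -
  have ext: "x \<in> extensional {1..N}" using x by (simp add: configs_iff)
  have "(if gap (undo x e) i = 1 then of_bool (x i = undo x e i)
             else if x i = undo x e i + 1 then p else if x i = undo x e i then 1 - p else 0)
          * (1 - p * of_bool (gap (undo x e) i = 1)) = hop_weight (e i)"
    if i: "i \<in> {1..N}" for i
  proof -
    have "e i = 0" if "gap (undo x e) i = 1"
    proof (rule ccontr)
      assume "e i \<noteq> 0"
      then have "e i = 1" using hopsD[OF e i] by simp
      then have "gap x i = e (ahead i)" using that gap_undo[OF i, of x e] by simp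
      moreover have "1 \<le> gap x i" using x i by (auto simp: configs_iff)
      ultimately show False using hopsD(2)[OF e i] hopsD(1)[OF e ahead_behind(1)[OF i]] by auto
    qed
    then show ?thesis using hopsD(1)[OF e i] i by (auto simp: hop_weight_def undo_def)
  qed
  then show ?thesis
    using ext unfolding pmf_tasep_step[OF undo_configs[OF x e]] blocking_factor_def
    by (simp add: prod.distrib[symmetric])
qed

lemma tasep_step_hops:
  assumes x: "x \<in> configs N L" and x': "x' \<in> configs N L" and nz: "pmf (tasep_step N L p x') x \<noteq> 0"
  shows "x' \<in> undo x ` hops x"
proof -
  note hop = tasep_step_moves(2)[OF x' nz]
  define e where "e = (\<lambda>i\<in>{1..N}. x i - x' i)"
  have "x' = undo x e"
    using x' by (auto simp: e_def undo_def configs_iff extensional_def fun_eq_iff)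
  moreover have "e \<in> hops x"
    unfolding hops_def
  proof (rule PiE_I)
    fix i assume i: "i \<in> {1..N}"
    define j where "j = behind i"
    have j: "j \<in> {1..N}" "ahead j = i" using ahead_behind[OF i] by (auto simp: j_def)
    have "e i = 0" if g: "gap x j = 1"
    proof (rule ccontr)
      assume "e i \<noteq> 0"
      then have "x i = x' i + 1" using hop[OF i] i by (auto simp: e_def)
      moreover have "gap x j = gap x' j + (x i - x' i) - (x j - x' j)"
        using j by (simp add: right_nbr_ahead)
      moreover have "1 \<le> gap x' j" using x' j by (auto simp: configs_iff)
      ultimately show False using g hop[OF j(1)] by auto
    qed
    then show "e i \<in> (if gap x (behind i) = 1 then {0} else {0, 1})"
      using hop[OF i] i by (auto simp: e_def j_def)
  qed (auto simp: e_def)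
  ultimately show ?thesis by blast
qed

text \<open>By \<open>step_weight\<close>, the transition probability divided by the blocking factor evolves like that of
  free particles, up to the restriction in \<open>hops\<close>.\<close>

theorem trans_prob_Suc:
  assumes x: "x \<in> configs N L" and y: "y \<in> configs N L"
  shows "trans_prob N L p (Suc t) y x =
    (\<Sum>e\<in>hops x. (\<Prod>i\<in>{1..N}. hop_weight (e i)) * (trans_prob N L p t y (undo x e) / blocking_factor (undo x e)))"
proof -
  have inj: "inj_on (undo x) (hops x)"
  proof (rule inj_onI)
    fix e e' assume "e \<in> hops x" "e' \<in> hops x" and eq: "undo x e = undo x e'"
    then have "e \<in> extensional {1..N}" "e' \<in> extensional {1..N}" by (auto simp: hops_def PiE_def)
    moreover have "e i = e' i" if "i \<in> {1..N}" for i
      using fun_cong[OF eq, of i] that by (simp add: undo_def)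
    ultimately show "e = e'" by (rule extensionalityI)
  qed
  have "trans_prob N L p (Suc t) y x
      = measure_pmf.expectation (tasep_pmf N L p t y) (\<lambda>x'. pmf (tasep_step N L p x') x)"
    by (simp add: trans_prob_def pmf_bind)
  also have "\<dots> = (\<Sum>x'\<in>undo x ` hops x. pmf (tasep_step N L p x') x * trans_prob N L p t y x')"
    unfolding trans_prob_def using tasep_step_hops[OF x] tasep_pmf_configs[OF y]
    by (intro integral_measure_pmf_real) (auto simp: finite_hops)
  also have "\<dots> = (\<Sum>e\<in>hops x. pmf (tasep_step N L p (undo x e)) x * trans_prob N L p t y (undo x e))"
    using inj by (simp add: sum.reindex)
  also have "\<dots> = (\<Sum>e\<in>hops x. (\<Prod>i\<in>{1..N}. hop_weight (e i)) * (trans_prob N L p t y (undo x e) / blocking_factor (undo x e)))"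
  proof (intro sum.cong refl)
    fix e assume "e \<in> hops x"
    then show "pmf (tasep_step N L p (undo x e)) x * trans_prob N L p t y (undo x e)
      = (\<Prod>i\<in>{1..N}. hop_weight (e i)) * (trans_prob N L p t y (undo x e) / blocking_factor (undo x e))"
      using blocking_factor_pos[of "undo x e"] step_weight[OF x, of e] by (simp add: field_simps)
  qed
  finally show ?thesis .
qed

section \<open>The determinant satisfies the evolution equation\<close>

text \<open>
  Row \<open>i\<close> of the matrix belongs to particle \<open>N - i\<close>, so rows run from left to right along the
  line. A row is tailed if its particle has another one directly behind it.
\<close>

definition tailed :: "(nat \<Rightarrow> int) \<Rightarrow> nat \<Rightarrow> bool" where
  "tailed x i \<longleftrightarrow> lift x (int i) = lift x (int i - 1) + 1"

lemma lift_pred: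
  assumes "i < N"
  shows "lift x (int i) - lift x (int i - 1) = gap x (behind (N - i))"
proof (cases "i = 0")
  case True
  have "lift x (int (N - 1) + (- 1) * int N) = lift x (int (N - 1)) + (- 1) * int L" by (rule lift_shift)
  then have "lift x (- 1) = x 1 - int L" using lift_of_nat[of "N - 1" x] N_pos by simp
  then show ?thesis using True lift_of_nat[of 0 x] N_pos by (simp add: behind_def right_nbr_def)
next
  case False
  have "int i - 1 = int (i - 1)" "i - 1 < N" using assms False by auto
  then have "lift x (int i - 1) = x (N - (i - 1))" by (simp only: lift_of_nat)
  moreover have "N - (i - 1) = N - i + 1" "N - (i - 1) \<noteq> 1" "N - i \<noteq> N" using False assms by auto
  ultimately show ?thesis using assms by (simp add: lift_of_nat behind_def right_nbr_def)
qed

lemma tailed_iff_gap: "i < N \<Longrightarrow> tailed x i \<longleftrightarrow> gap x (behind (N - i)) = 1"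
  using lift_pred[of i x] by (auto simp: tailed_def)

lemma bij_row_particle: "bij_betw (\<lambda>i. N - i) {1..N} {0..<N}" "bij_betw (\<lambda>i. N - i) {0..<N} {1..N}"
  by (rule bij_betwI[where g = "\<lambda>i. N - i"]; auto)+

lemma blocking_factor_rows: "blocking_factor x = (\<Prod>i<N. 1 - p * of_bool (tailed x i))"
proof -
  have "blocking_factor x = (\<Prod>i\<in>{1..N}. 1 - p * of_bool (gap x (behind i) = 1))"
    unfolding blocking_factor_def by (rule prod.reindex_bij_betw[OF bij_behind, symmetric])
  also have "\<dots> = (\<Prod>i\<in>{0..<N}. 1 - p * of_bool (gap x (behind (N - i)) = 1))"
    by (rule prod.reindex_bij_betw[OF bij_row_particle(2), symmetric])
  also have "\<dots> = (\<Prod>i<N. 1 - p * of_bool (tailed x i))"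
    by (intro prod.cong) (auto simp: tailed_iff_gap)
  finally show ?thesis .
qed

text \<open>A full block of \<open>N\<close> adjacent particles would have period \<open>N\<close> instead of \<open>L\<close>.\<close>

lemma exists_not_tailed: "\<exists>i<N. \<not> tailed x i"
proof (rule ccontr)
  assume "\<not> (\<exists>i<N. \<not> tailed x i)"
  then have t: "\<And>i. i < N \<Longrightarrow> lift x (int i) = lift x (int i - 1) + 1" by (auto simp: tailed_def)
  have "lift x (int n - 1) = lift x (- 1) + int n" if "n \<le> N" for n
    using that by (induction n) (use t in auto)
  from this[of N] have "lift x (int N - 1) = lift x (- 1) + int N" by simp
  moreover have "lift x (- 1 + 1 * int N) = lift x (- 1) + 1 * int L" by (rule lift_shift)
  ultimately show False using N_less by (simp add: algebra_simps)
qed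

text \<open>
  The argument \<open>s\<close> is an additional power of \<open>1 + p w\<close>. Rows with different \<open>s\<close> occur while a time step is being
  distributed over the rows.
\<close>

definition bethe_entry :: "complex \<Rightarrow> nat \<Rightarrow> (nat \<Rightarrow> int) \<Rightarrow> (nat \<Rightarrow> int) \<Rightarrow> int \<Rightarrow> nat \<Rightarrow> nat \<Rightarrow> complex" where
  "bethe_entry z t x y s i j =
     root_trace z (int j - int i) (y (N - j) - x (N - i) + int i - int j - 1) (int t + int i - int j + s)"

definition bethe_mat :: "complex \<Rightarrow> nat \<Rightarrow> (nat \<Rightarrow> int) \<Rightarrow> (nat \<Rightarrow> int) \<Rightarrow> (nat \<Rightarrow> int) \<Rightarrow> complex Matrix.mat" where
  "bethe_mat z t x y s = Matrix.mat N N (\<lambda>(i, j). bethe_entry z t x y (s i) i j)"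

lemma bethe_mat_carrier [simp]: "bethe_mat z t x y s \<in> carrier_mat N N"
  by (simp add: bethe_mat_def)

lemma det_bethe_mat_expand:
  "Determinant.det (bethe_mat z t x y s)
      = (\<Sum>\<pi>\<in>{\<pi>. \<pi> permutes {0..<N}}. signof \<pi> * (\<Prod>i = 0..<N. bethe_entry z t x y (s i) i (\<pi> i)))"
    unfolding det_def'[OF bethe_mat_carrier]
proof (intro sum.cong arg_cong2[where f = "(*)"] refl prod.cong)
  fix \<pi> i assume "\<pi> \<in> {\<pi>. \<pi> permutes {0..<N}}" "i \<in> {0..<N}"
  then have "i < N" "\<pi> i < N" using permutes_in_image[of \<pi> "{0..<N}" i] by auto
  then show "bethe_mat z t x y s $$ (i, \<pi> i) = bethe_entry z t x y (s i) i (\<pi> i)" by (simp add: bethe_mat_def)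
qed

lemma root_sum_mat_eq:
  assumes "z \<noteq> 0"
  shows "root_sum_mat N L p x y t z = bethe_mat z t x y (\<lambda>_. 0)"
  unfolding root_sum_mat_def bethe_mat_def
proof (rule eq_matI; clarsimp)
  fix i j assume "i < N" "j < N"
  then have "N - Suc i + 1 = N - i" "N - Suc j + 1 = N - j" by auto
  then show "root_sum N L p (Suc i) (Suc j) x y t z = bethe_entry z t x y 0 i j"
    using root_sum_eq_root_trace[OF assms, of "Suc i" "Suc j" x y t] by (simp add: bethe_entry_def add_ac)
qed

text \<open>
  If particle \<open>i - 1\<close> stands one site behind particle \<open>i\<close>, the monomials of the two rows differ
  by the factor \<open>w / (1 + p w)\<close>, so that \<open>1 + p w\<close> is absorbed by the row behind. For \<open>i = 0\<close> the row
  behind is the periodic copy of row \<open>N - 1\<close>, which brings in the factor \<open>z ^ L\<close>.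
\<close>

lemma bethe_entry_row_relation:
  assumes z: "z \<noteq> 0" and i: "i < N" and tl: "tailed x i"
  shows "bethe_entry z t x y (s - 1) i j = bethe_entry z t x y s i j
    - of_real p * ((if i = 0 then z ^ L else 1) * bethe_entry z t x y s (if i = 0 then N - 1 else i - 1) j)"
proof -
  let ?a = "int j - int i" and ?b = "y (N - j) - x (N - i) + int i - int j - 1"
    and ?c = "int t + int i - int j + s"
  have xi: "x (N - i) = lift x (int i - 1) + 1" using tl lift_of_nat[OF i, of x] by (simp add: tailed_def)
  have "bethe_entry z t x y s i j = bethe_entry z t x y (s - 1) i j + of_real p * root_trace z (?a + 1) ?b (?c - 1)"
    unfolding bethe_entry_def by (subst root_trace_pole_factor) (simp add: algebra_simps)
  moreover have "root_trace z (?a + 1) ?b (?c - 1)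
      = (if i = 0 then z ^ L else 1) * bethe_entry z t x y s (if i = 0 then N - 1 else i - 1) j"
  proof (cases "i = 0")
    case True
    have N1: "N - 1 < N" "int (N - 1) = int N - 1" using N_pos by auto
    have "lift x (int (N - 1) + (- 1) * int N) = lift x (int (N - 1)) + (- 1) * int L" by (rule lift_shift)
    then have "x (N - i) = x (N - (N - 1)) - int L + 1"
      using xi True lift_of_nat[OF N1(1), of x] N1 by simp
    then have "bethe_entry z t x y s (N - 1) j
        = root_trace z (?a + 1 - int N) (?b - (int L - int N)) (?c - 1 + int N)"
    proof -
      assume "x (N - i) = x (N - (N - 1)) - int L + 1"
      then have "int j - int (N - 1) = ?a + 1 - int N"
        "y (N - j) - x (N - (N - 1)) + int (N - 1) - int j - 1 = ?b - (int L - int N)"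
        "int t + int (N - 1) - int j + s = ?c - 1 + int N"
        using True N1(2) by simp_all
      then show ?thesis unfolding bethe_entry_def by (simp only:)
    qed
    also have "\<dots> = z powi (- int L) * root_trace z (?a + 1) ?b (?c - 1)"
      by (rule root_trace_shift[OF z])
    finally show ?thesis using True z by (simp add: power_int_minus)
  next
    case False
    have i1: "int (i - 1) = int i - 1" "i - 1 < N" using False i by auto
    have "x (N - i) = x (N - (i - 1)) + 1" using xi lift_of_nat[OF i1(2), of x] i1(1) by simp
    then show ?thesis using False i1 by (simp add: bethe_entry_def algebra_simps)
  qed
  ultimately show ?thesis by (simp add: algebra_simps)
qed

text \<open>
  All row operations are performed at once by a matrix \<open>U\<close> that has ones on the diagonal
  and at most one other nonzero entry in each row, in the preceding column of the cycle. A permutation contributing to its determinant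
  moves each index to itself or to its predecessor, and it fixes a row that is not tailed; being
  injective it then fixes the next index as well, and so on around the cycle.
\<close>

lemma det_bethe_mat_tailed:
  assumes z: "z \<noteq> 0"
  shows "Determinant.det (bethe_mat z t x y (\<lambda>i. s - of_bool (tailed x i)))
    = Determinant.det (bethe_mat z t x y (\<lambda>_. s))"
proof -
  define prev where "prev i = (if i = 0 then N - 1 else i - 1)" for i
  define c where "c i = (if tailed x i then of_real p * (if i = 0 then z ^ L else 1) else 0)" for i
  define U where "U = Matrix.mat N N (\<lambda>(i, k). of_bool (k = i) - of_bool (k = prev i) * c i)"
  have U: "U \<in> carrier_mat N N" by (simp add: U_def)
  have U_entry: "U $$ (i, k) = of_bool (k = i) - of_bool (k = prev i) * c i" if "i < N" "k < N" for i k
    using that by (simp add: U_def)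
  have prev: "prev i < N" if "i < N" for i using that by (auto simp: prev_def)
  obtain i0 where i0: "i0 < N" "\<not> tailed x i0" using exists_not_tailed by blast
  have prev_neq: "prev i \<noteq> i" if "i < N" "tailed x i" for i
    using that i0 by (cases "N = 1") (auto simp: prev_def)
  have "bethe_mat z t x y (\<lambda>i. s - of_bool (tailed x i)) = U * bethe_mat z t x y (\<lambda>_. s)"
  proof (rule eq_matI)
    fix i j assume "i < dim_row (U * bethe_mat z t x y (\<lambda>_. s))" "j < dim_col (U * bethe_mat z t x y (\<lambda>_. s))"
    then have ij: "i < N" "j < N" by (auto simp: U_def bethe_mat_def)
    have "(U * bethe_mat z t x y (\<lambda>_. s)) $$ (i, j)
        = (\<Sum>k = 0..<N. (of_bool (k = i) - of_bool (k = prev i) * c i) * bethe_entry z t x y s k j)"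
      using ij by (simp add: U_def bethe_mat_def scalar_prod_def)
    also have "\<dots> = (\<Sum>k = 0..<N. (if k = i then bethe_entry z t x y s k j else 0)
        - (if k = prev i then c i * bethe_entry z t x y s k j else 0))"
      by (intro sum.cong) (auto simp: algebra_simps)
    also have "\<dots> = (\<Sum>k = 0..<N. (if k = i then bethe_entry z t x y s k j else 0))
        - (\<Sum>k = 0..<N. (if k = prev i then c i * bethe_entry z t x y s k j else 0))"
      by (rule sum_subtractf)
    also have "\<dots> = bethe_entry z t x y s i j - c i * bethe_entry z t x y s (prev i) j"
      using ij prev[OF ij(1)] by simp
    also have "\<dots> = bethe_entry z t x y (s - of_bool (tailed x i)) i j"
      using bethe_entry_row_relation[OF z ij(1), of x t y s j] by (auto simp: c_def prev_def)
    finally show "bethe_mat z t x y (\<lambda>i. s - of_bool (tailed x i)) $$ (i, j)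
        = (U * bethe_mat z t x y (\<lambda>_. s)) $$ (i, j)"
      using ij by (simp add: bethe_mat_def)
  qed (simp_all add: U_def bethe_mat_def)
  moreover have "Determinant.det U = 1"
  proof -
    have "Determinant.det U = (\<Prod>i<N. U $$ (i, i))"
    proof (rule det_only_identity[OF U])
      fix \<pi> assume perm: "\<pi> permutes {0..<N}" and nz: "\<And>i. i < N \<Longrightarrow> U $$ (i, \<pi> i) \<noteq> 0"
      have lt: "\<pi> i < N" if "i < N" for i using permutes_in_image[OF perm, of i] that by simp
      have opt: "\<pi> i = i \<or> \<pi> i = prev i \<and> tailed x i" if "i < N" for i
        using nz[OF that] U_entry[OF that lt[OF that]] by (auto simp: c_def of_bool_def split: if_splits)
      have move: "\<pi> i = i" if "i < N" "\<pi> (prev i) = prev i" for i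
        using opt[OF that(1)] that(2) permutes_inj[OF perm] by (metis injD)
      have "\<pi> i = i" if "i < N" for i
        using that
      proof (rule cyclic_nat_induct[rotated 4])
        show "i0 < N" "\<pi> i0 = i0" using i0 opt by auto
        show "\<pi> i = i" if "0 < i" "i < N" "\<pi> (i - 1) = i - 1" for i
          using move[of i] that by (simp add: prev_def)
        show "\<pi> 0 = 0" if "\<pi> (N - 1) = N - 1"
          using move[of 0] that N_pos by (simp add: prev_def)
      qed
      moreover have "\<pi> i = i" if "\<not> i < N" for i using permutes_not_in[OF perm, of i] that by simp
      ultimately show "\<pi> = id" by (metis eq_id_iff)
    qed
    also have "\<dots> = 1"
      by (intro prod.neutral ballI) (use prev_neq U_entry in \<open>force simp: c_def\<close>)
    finally show ?thesis .
  qed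
  ultimately show ?thesis by (simp add: det_mult[OF U bethe_mat_carrier])
qed

text \<open>
  Multilinearity: a row that is not tailed carries the factor \<open>1 + p w\<close> and splits into the two terms of
  \<open>root_trace_hop\<close>; a tailed row does not carry it, and the factor \<open>1 - p\<close> of its particle staying put
  comes from the blocking factor.
\<close>

lemma det_bethe_mat_hops:
  "of_real (blocking_factor x) * Determinant.det (bethe_mat z t x y (\<lambda>i. 1 - of_bool (tailed x i)))
    = (\<Sum>e\<in>hops x. of_real (\<Prod>i\<in>{1..N}. hop_weight (e i)) * Determinant.det (bethe_mat z t (undo x e) y (\<lambda>_. 0)))"
proof -
  let ?P = "{\<pi>. \<pi> permutes {0..<N}}"
  have expand: "of_real (blocking_factor x) * (\<Prod>i = 0..<N. bethe_entry z t x y (1 - of_bool (tailed x i)) i (\<pi> i))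
      = (\<Sum>e\<in>hops x. of_real (\<Prod>i\<in>{1..N}. hop_weight (e i)) * (\<Prod>i = 0..<N. bethe_entry z t (undo x e) y 0 i (\<pi> i)))"
    for \<pi>
  proof -
    have "of_real (blocking_factor x) * (\<Prod>i = 0..<N. bethe_entry z t x y (1 - of_bool (tailed x i)) i (\<pi> i))
        = (\<Prod>i = 0..<N. of_real (1 - p * of_bool (tailed x i)) * bethe_entry z t x y (1 - of_bool (tailed x i)) i (\<pi> i))"
      by (simp add: blocking_factor_rows prod.distrib lessThan_atLeast0)
    also have "\<dots> = (\<Prod>r\<in>{1..N}. of_real (1 - p * of_bool (tailed x (N - r)))
        * bethe_entry z t x y (1 - of_bool (tailed x (N - r))) (N - r) (\<pi> (N - r)))"
      by (rule prod.reindex_bij_betw[OF bij_row_particle(1), symmetric])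
    also have "\<dots> = (\<Prod>r\<in>{1..N}. \<Sum>e\<in>(if gap x (behind r) = 1 then {0} else {0, 1}).
        of_real (hop_weight e) * root_trace z (int (\<pi> (N - r)) - int (N - r))
          (y (N - \<pi> (N - r)) - (x r - e) + int (N - r) - int (\<pi> (N - r)) - 1)
          (int t + int (N - r) - int (\<pi> (N - r))))"
    proof (intro prod.cong refl)
      fix r assume r: "r \<in> {1..N}"
      let ?i = "N - r" let ?j = "\<pi> (N - r)"
      have Nr: "?i < N" "N - ?i = r" using r by auto
      have "root_trace z (int ?j - int ?i) (y (N - ?j) - x r + int ?i - int ?j - 1) (int t + int ?i - int ?j + 1)
        = (1 - of_real p) * root_trace z (int ?j - int ?i) (y (N - ?j) - x r + int ?i - int ?j - 1) (int t + int ?i - int ?j)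
        + of_real p * root_trace z (int ?j - int ?i) (y (N - ?j) - (x r - 1) + int ?i - int ?j - 1) (int t + int ?i - int ?j)"
        by (subst root_trace_hop) (simp add: algebra_simps)
      then show "of_real (1 - p * of_bool (tailed x ?i)) * bethe_entry z t x y (1 - of_bool (tailed x ?i)) ?i ?j
        = (\<Sum>e\<in>(if gap x (behind r) = 1 then {0} else {0, 1}).
        of_real (hop_weight e) * root_trace z (int ?j - int ?i)
          (y (N - ?j) - (x r - e) + int ?i - int ?j - 1) (int t + int ?i - int ?j))"
        using tailed_iff_gap[OF Nr(1), of x] Nr(2) by (auto simp: bethe_entry_def hop_weight_def)
    qed
    also have "\<dots> = (\<Sum>e\<in>hops x. \<Prod>r\<in>{1..N}. of_real (hop_weight (e r)) * root_trace z (int (\<pi> (N - r)) - int (N - r))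
          (y (N - \<pi> (N - r)) - (x r - e r) + int (N - r) - int (\<pi> (N - r)) - 1)
          (int t + int (N - r) - int (\<pi> (N - r))))"
      unfolding hops_def by (rule prod_sum_PiE) auto
    also have "\<dots> = (\<Sum>e\<in>hops x. of_real (\<Prod>i\<in>{1..N}. hop_weight (e i)) * (\<Prod>i = 0..<N. bethe_entry z t (undo x e) y 0 i (\<pi> i)))"
    proof (intro sum.cong refl)
      fix e assume "e \<in> hops x"
      have "(\<Prod>i = 0..<N. bethe_entry z t (undo x e) y 0 i (\<pi> i)) = (\<Prod>r\<in>{1..N}. bethe_entry z t (undo x e) y 0 (N - r) (\<pi> (N - r)))"
        by (rule prod.reindex_bij_betw[OF bij_row_particle(1), symmetric])
      also have "\<dots> = (\<Prod>r\<in>{1..N}. root_trace z (int (\<pi> (N - r)) - int (N - r))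
          (y (N - \<pi> (N - r)) - (x r - e r) + int (N - r) - int (\<pi> (N - r)) - 1)
          (int t + int (N - r) - int (\<pi> (N - r))))"
        by (intro prod.cong) (auto simp: bethe_entry_def undo_def)
      finally show "(\<Prod>r\<in>{1..N}. of_real (hop_weight (e r)) * root_trace z (int (\<pi> (N - r)) - int (N - r))
          (y (N - \<pi> (N - r)) - (x r - e r) + int (N - r) - int (\<pi> (N - r)) - 1)
          (int t + int (N - r) - int (\<pi> (N - r))))
        = of_real (\<Prod>i\<in>{1..N}. hop_weight (e i)) * (\<Prod>i = 0..<N. bethe_entry z t (undo x e) y 0 i (\<pi> i))"
        by (simp add: prod.distrib)
    qed
    finally show ?thesis .
  qed
  have "of_real (blocking_factor x) * Determinant.det (bethe_mat z t x y (\<lambda>i. 1 - of_bool (tailed x i)))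
      = (\<Sum>\<pi>\<in>?P. signof \<pi> * (of_real (blocking_factor x) * (\<Prod>i = 0..<N. bethe_entry z t x y (1 - of_bool (tailed x i)) i (\<pi> i))))"
    by (simp add: det_bethe_mat_expand sum_distrib_left mult_ac)
  also have "\<dots> = (\<Sum>\<pi>\<in>?P. \<Sum>e\<in>hops x. of_real (\<Prod>i\<in>{1..N}. hop_weight (e i))
      * (signof \<pi> * (\<Prod>i = 0..<N. bethe_entry z t (undo x e) y 0 i (\<pi> i))))"
    unfolding expand by (simp add: sum_distrib_left mult_ac)
  also have "\<dots> = (\<Sum>e\<in>hops x. \<Sum>\<pi>\<in>?P. of_real (\<Prod>i\<in>{1..N}. hop_weight (e i))
      * (signof \<pi> * (\<Prod>i = 0..<N. bethe_entry z t (undo x e) y 0 i (\<pi> i))))"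
    by (rule sum.swap)
  also have "\<dots> = (\<Sum>e\<in>hops x. of_real (\<Prod>i\<in>{1..N}. hop_weight (e i)) * Determinant.det (bethe_mat z t (undo x e) y (\<lambda>_. 0)))"
    by (simp add: det_bethe_mat_expand sum_distrib_left)
  finally show ?thesis .
qed

theorem det_bethe_mat_Suc:
  assumes "z \<noteq> 0"
  shows "of_real (blocking_factor x) * Determinant.det (bethe_mat z (Suc t) x y (\<lambda>_. 0))
    = (\<Sum>e\<in>hops x. of_real (\<Prod>i\<in>{1..N}. hop_weight (e i)) * Determinant.det (bethe_mat z t (undo x e) y (\<lambda>_. 0)))"
proof -
  have "bethe_mat z (Suc t) x y (\<lambda>_. 0) = bethe_mat z t x y (\<lambda>_. 1)"
    unfolding bethe_mat_def bethe_entry_def by (intro cong_mat) (auto simp: algebra_simps)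
  then show ?thesis
    using det_bethe_mat_tailed[OF assms, of t x y 1] det_bethe_mat_hops[of x z t y] by (simp only:)
qed

section \<open>The initial condition\<close>

text \<open>
  By \<open>lift_mono\<close> this is weakly increasing. The exponents of \<open>w + 1\<close>, which decide whether a residue
  vanishes, are a value for \<open>y\<close> minus a value for \<open>x\<close>, minus one.
\<close>

definition slack :: "(nat \<Rightarrow> int) \<Rightarrow> int \<Rightarrow> int" where
  "slack x k = lift x k - k"

lemma slack_shift: "slack x (k + m * int N) = slack x k + m * (int L - int N)"
  by (simp add: slack_def lift_shift algebra_simps)

lemma slack_mono: "x \<in> configs N L \<Longrightarrow> k \<le> l \<Longrightarrow> slack x k \<le> slack x l"
  unfolding slack_def by (rule lift_mono)

lemma slack_pred:
  assumes "x \<in> configs N L"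
  shows "slack x (int i - 1) < slack x (int i) + of_bool (tailed x i)"
    "tailed x i \<Longrightarrow> slack x (int i - 1) = slack x (int i)"
  using lift_step[OF assms, of "int i - 1"] by (auto simp: slack_def tailed_def)

text \<open>
  The coefficient of \<open>z ^ (L * m)\<close> in the entry \<open>(i, j)\<close> at time \<open>0\<close>, after the row operations, depends
  on \<open>j\<close> and \<open>m\<close> only through the column \<open>k = j - m * N\<close> of the periodically continued system.
\<close>

definition affine_factor :: "(nat \<Rightarrow> int) \<Rightarrow> (nat \<Rightarrow> int) \<Rightarrow> nat \<Rightarrow> int \<Rightarrow> complex" where
  "affine_factor x y i k =
     inner_res (k - int i) (slack y k - slack x (int i) - 1) (int i - k - of_bool (tailed x i))"

text \<open>
  On and to the right of the diagonal there is no pole at \<open>0\<close>, so a nonzero coefficient needs one at \<open>-1\<close>; to the left of it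
  there is none at \<open>-1/p\<close>, so a nonzero coefficient needs a residue at infinity. On the diagonal of a row that is not
  tailed both apply.
\<close>

lemma affine_factor_nonzero:
  assumes "affine_factor x y i k \<noteq> 0"
  shows "k \<ge> int i \<Longrightarrow> slack y k \<le> slack x (int i)"
    "k < int i \<Longrightarrow> slack x (int i) + of_bool (tailed x i) \<le> slack y k"
    "k = int i \<Longrightarrow> \<not> tailed x i \<Longrightarrow> slack y k = slack x (int i)"
proof -
  show *: "slack y k \<le> slack x (int i)" if "k \<ge> int i"
    using assms that inner_res_eq_0_nonneg[of "k - int i" "slack y k - slack x (int i) - 1"]
    by (force simp: affine_factor_def)
  have low: "- 1 \<le> (k - int i) + (slack y k - slack x (int i) - 1) + (int i - k - of_bool (tailed x i))"
    if "int i - k - of_bool (tailed x i) \<ge> 0"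
    using assms inner_res_eq_0_infinity[OF that] by (force simp: affine_factor_def)
  show "slack x (int i) + of_bool (tailed x i) \<le> slack y k" if "k < int i"
  proof -
    have "0 \<le> int i - k - of_bool (tailed x i)" using that by (simp add: of_bool_def)
    from low[OF this] show ?thesis by simp
  qed
  show "slack y k = slack x (int i)" if "k = int i" "\<not> tailed x i"
    using low * that by simp
qed

text \<open>
  Let \<open>\<tau> i = \<pi> i - g i * N\<close>, extended periodically to a bijection of the integers. If \<open>\<tau>\<close> moved some \<open>i\<close> to the left,
  then slack \<open>y\<close> at \<open>\<tau> i\<close> would exceed slack \<open>x\<close> at \<open>i - 1\<close>. An index \<open>j \<le> i - 1\<close> moved to the right across
  \<open>i\<close> would give the opposite inequality, by monotonicity. So \<open>\<tau>\<close> maps all indices up to \<open>i\<close> to indices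
  below \<open>i\<close>, which is incompatible with total degree zero. Hence \<open>\<tau>\<close> never moves to the left, and
  by total degree zero it is the identity.
\<close>

lemma affine_permutation_trivial:
  assumes x: "x \<in> configs N L" and y: "y \<in> configs N L"
    and perm: "\<pi> permutes {0..<N}" and deg: "(\<Sum>i = 0..<N. g i) = 0"
    and nz: "\<And>i. i < N \<Longrightarrow> affine_factor x y i (int (\<pi> i) - g i * int N) \<noteq> 0"
  shows "i < N \<Longrightarrow> \<pi> i = i" "i < N \<Longrightarrow> g i = 0"
proof -
  define \<tau> where "\<tau> i = int (\<pi> i) - g i * int N" for i
  have lt: "\<pi> i < N" if "i < N" for i using permutes_in_image[OF perm, of i] that by simp
  have perm_sum: "(\<Sum>i = 0..<N. h (\<pi> i)) = (\<Sum>i = 0..<N. h i)" for h :: "nat \<Rightarrow> int"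
    using sum.permute[OF perm, of h] by (simp add: o_def)
  have sum_\<tau>: "(\<Sum>i = 0..<N. \<tau> i) = (\<Sum>i = 0..<N. int i)"
    using deg perm_sum[of int] by (simp add: \<tau>_def sum_subtractf flip: sum_distrib_right)
  have up: "int i \<le> \<tau> i" if "i < N" for i
  proof (rule ccontr)
    assume "\<not> int i \<le> \<tau> i"
    then have down: "\<tau> i < int i" by simp
    \<comment> \<open>Subtracting \<open>d j * N\<close> translates the window \<open>{0..<N}\<close> to \<open>{i - N<..i}\<close>, whose last element is \<open>i\<close>.\<close>
    define d where "d j = (if j > i then 1 else 0 :: int)" for j
    have low: "\<tau> j - d j * int N < int i" if j: "j < N" for j
    proof (rule ccontr)
      assume "\<not> \<tau> j - d j * int N < int i"
      then have ge: "int i \<le> \<tau> j - d j * int N" by simp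
      then have "j \<noteq> i" using down by (auto simp: d_def)
      then have jd: "int j - d j * int N \<le> int i - 1" using j \<open>i < N\<close> by (auto simp: d_def)
      have "slack y (\<tau> j) \<le> slack x (int j)"
        using affine_factor_nonzero(1)[OF nz[OF j]] ge jd unfolding \<tau>_def by linarith
      then have "slack y (\<tau> j - d j * int N) \<le> slack x (int j - d j * int N)"
        using slack_shift[of y "\<tau> j" "- d j"] slack_shift[of x "int j" "- d j"] by simp
      also have "\<dots> \<le> slack x (int i - 1)" using jd by (rule slack_mono[OF x])
      also have "\<dots> < slack y (\<tau> i)"
        using affine_factor_nonzero(2)[OF nz[OF \<open>i < N\<close>]] down slack_pred(1)[OF x, of i]
        unfolding \<tau>_def by linarith
      also have "\<dots> \<le> slack y (\<tau> j - d j * int N)" using ge down by (intro slack_mono[OF y]) simp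
      finally show False by simp
    qed
    \<comment> \<open>\<open>\<tau> j - d j * N\<close> and the representative of \<open>\<pi> j\<close> in the window differ by a multiple of \<open>N\<close>; as the
      former is below \<open>i\<close>, it is at most the latter, and smaller by at least \<open>N\<close> if the representative is \<open>i\<close> itself.\<close>
    have step: "\<tau> j - d j * int N \<le> int (\<pi> j) - d (\<pi> j) * int N - of_bool (\<pi> j = i) * int N" if j: "j < N" for j
    proof -
      define q where "q = d (\<pi> j) - g j - d j"
      have eq: "\<tau> j - d j * int N = int (\<pi> j) - d (\<pi> j) * int N + q * int N"
        by (simp add: \<tau>_def q_def algebra_simps)
      define b where "b = (if \<pi> j = i then 0 else 1 :: int)"
      have "q < b"
      proof (rule ccontr)
        assume "\<not> q < b"
        then have "b * int N \<le> q * int N" by (intro mult_right_mono) auto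
        moreover define Q where "Q = q * int N"
        ultimately show False
          using low[OF j] lt[OF j] \<open>i < N\<close> unfolding eq Q_def[symmetric] by (cases "\<pi> j = i") (auto simp: d_def b_def split: if_splits)
      qed
      then have "q * int N \<le> (b - 1) * int N" by (intro mult_right_mono) auto
      then show ?thesis using eq by (auto simp: b_def)
    qed
    have "(\<Sum>j = 0..<N. \<tau> j - d j * int N)
        \<le> (\<Sum>j = 0..<N. int (\<pi> j) - d (\<pi> j) * int N - of_bool (\<pi> j = i) * int N)"
      using step by (intro sum_mono) simp
    also have "\<dots> = (\<Sum>j = 0..<N. int j - d j * int N - of_bool (j = i) * int N)"
      by (rule perm_sum[of "\<lambda>j. int j - d j * int N - of_bool (j = i) * int N"])
    also have "\<dots> = (\<Sum>j = 0..<N. \<tau> j - d j * int N) - int N"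
      using \<open>i < N\<close> sum_\<tau> by (simp add: sum_subtractf of_bool_def flip: sum_distrib_right)
    finally show False using N_pos by simp
  qed
  have eq: "\<tau> i = int i" if "i < N" for i
  proof -
    have "(\<Sum>j = 0..<N. \<tau> j - int j) = 0" using sum_\<tau> by (simp add: sum_subtractf)
    then have "\<forall>j\<in>{0..<N}. \<tau> j - int j = 0"
      using up by (subst (asm) sum_nonneg_eq_0_iff) auto
    then show ?thesis using that by simp
  qed
  have g0: "g i = 0" if "i < N" for i
  proof (rule ccontr)
    assume "g i \<noteq> 0"
    then have "1 * int N \<le> \<bar>g i\<bar> * int N" by (intro mult_right_mono) auto
    moreover have "g i * int N = int (\<pi> i) - int i" using eq[OF that] by (simp add: \<tau>_def)
    moreover have "\<bar>g i\<bar> * int N = \<bar>g i * int N\<bar>" by (simp add: abs_mult)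
    moreover have "\<bar>int (\<pi> i) - int i\<bar> < int N" using lt[OF that] that by auto
    ultimately show False by simp
  qed
  show "g i = 0" if "i < N" using g0 that .
  show "\<pi> i = i" if "i < N" using eq[OF that] g0[OF that] by (simp add: \<tau>_def)
qed

text \<open>
  On rows that are not tailed the positions agree. Inside a block of adjacent particles slack \<open>x\<close> is constant while
  slack \<open>y\<close> increases weakly and stays at most slack \<open>x\<close>, so the agreement propagates from the rear end of the block.
\<close>

lemma slack_eq_imp_eq:
  assumes x: "x \<in> configs N L" and y: "y \<in> configs N L"
    and nz: "\<And>i. i < N \<Longrightarrow> affine_factor x y i (int i) \<noteq> 0"
  shows "x = y"
proof -
  have up: "slack y (int i) = slack x (int i)"
    if i: "i < N" and prev: "slack y (int i - 1) = slack x (int i - 1)" for i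
  proof (cases "tailed x i")
    case True
    have "slack x (int i) = slack y (int i - 1)" using slack_pred(2)[OF x True] prev by simp
    also have "\<dots> \<le> slack y (int i)" by (rule slack_mono[OF y]) simp
    finally show ?thesis using affine_factor_nonzero(1)[OF nz[OF i]] by simp
  next
    case False
    then show ?thesis using affine_factor_nonzero(3)[OF nz[OF i]] by simp
  qed
  obtain i0 where i0: "i0 < N" "\<not> tailed x i0" using exists_not_tailed by blast
  have "slack y (int i) = slack x (int i)" if "i < N" for i
    using that
  proof (rule cyclic_nat_induct[rotated 4])
    show "i0 < N" "slack y (int i0) = slack x (int i0)"
      using i0 affine_factor_nonzero(3)[OF nz[OF i0(1)]] by auto
    show "slack y (int i) = slack x (int i)"
      if "0 < i" "i < N" "slack y (int (i - 1)) = slack x (int (i - 1))" for i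
      using up[of i] that by (simp add: of_nat_diff)
    show "slack y (int 0) = slack x (int 0)" if "slack y (int (N - 1)) = slack x (int (N - 1))"
    proof (rule up)
      have "int 0 - 1 = int (N - 1) + (- 1) * int N" using N_pos by simp
      then show "slack y (int 0 - 1) = slack x (int 0 - 1)" using that by (simp only: slack_shift)
    qed (use N_pos in simp)
  qed
  then have eq: "x (N - i) = y (N - i)" if "i < N" for i
    using that lift_of_nat[of i x] lift_of_nat[of i y] by (simp add: slack_def)
  have "x \<in> extensional {1..N}" "y \<in> extensional {1..N}" using x y by (auto simp: configs_iff)
  then show ?thesis
  proof (rule extensionalityI)
    fix i assume "i \<in> {1..N}"
    then show "x i = y i" using eq[of "N - i"] by auto
  qed
qed

text \<open>For \<open>x = y\<close> a tailed row contributes \<open>1 / (1 - p)\<close>, which cancels its blocking factor, any other row \<open>1\<close>.\<close>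

lemma affine_factor_diagonal:
  assumes x: "x \<in> configs N L" and y: "y \<in> configs N L"
  shows "of_real (blocking_factor x) * (\<Prod>i = 0..<N. affine_factor x y i (int i)) = of_bool (x = y)"
proof (cases "x = y")
  case True
  have "of_real (1 - p * of_bool (tailed x i)) * affine_factor x x i (int i) = 1" for i
    using inner_res_simple_pole p_less by (auto simp: affine_factor_def power_int_minus)
  then show ?thesis
    using True by (simp add: blocking_factor_rows lessThan_atLeast0 flip: prod.distrib)
next
  case False
  then obtain i where "i < N" "affine_factor x y i (int i) = 0" using slack_eq_imp_eq[OF x y] by blast
  then have "(\<Prod>i = 0..<N. affine_factor x y i (int i)) = 0" by (intro prod_zero) auto
  then show ?thesis using False by simp
qed

text \<open>The range of the summation is chosen uniformly in the matrix entry, so that the product of the rows can be expanded.\<close>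

lemma bethe_entry_laurent:
  "\<exists>K>0. \<forall>z. \<forall>i<N. \<forall>j<N. bethe_entry z 0 x y (- of_bool (tailed x i)) i j
    = (\<Sum>m\<in>{- K..<K}. z powi (int L * m) * affine_factor x y i (int j - m * int N))"
proof -
  define \<kappa> where "\<kappa> = (\<lambda>(i, j). \<bar>int j - int i\<bar> + \<bar>y (N - j) - x (N - i) + int i - int j - 1\<bar>
    + \<bar>int 0 + int i - int j + - of_bool (tailed x i)\<bar> + 2)"
  define K where "K = (\<Sum>a\<in>{..<N} \<times> {..<N}. \<kappa> a)"
  have \<kappa>_pos: "0 < \<kappa> a" for a by (auto simp: \<kappa>_def split: prod.split)
  have \<kappa>_le: "\<kappa> (i, j) \<le> K" if "i < N" "j < N" for i j
    unfolding K_def using that \<kappa>_pos by (intro member_le_sum) (auto intro: less_imp_le)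
  show ?thesis
  proof (intro exI conjI allI impI)
    show "0 < K" using \<kappa>_le[of 0 0] \<kappa>_pos[of "(0, 0)"] N_pos by linarith
    fix z i j assume i: "i < N" and j: "j < N"
    have y: "slack y (int j - m * int N) = y (N - j) - int j - m * (int L - int N)" for m
      using slack_shift[of y "int j" "- m"] lift_of_nat[OF j, of y] by (simp add: slack_def)
    have x: "slack x (int i) = x (N - i) - int i" using lift_of_nat[OF i] by (simp add: slack_def)
    have terms: "laurent_term z (int j - int i) (y (N - j) - x (N - i) + int i - int j - 1)
        (int 0 + int i - int j + - of_bool (tailed x i)) m
      = z powi (int L * m) * affine_factor x y i (int j - m * int N)" for m
    proof -
      have "int j - int i - m * int N = int j - m * int N - int i"
        "y (N - j) - x (N - i) + int i - int j - 1 - m * (int L - int N)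
          = slack y (int j - m * int N) - slack x (int i) - 1"
        "int 0 + int i - int j + - of_bool (tailed x i) + m * int N
          = int i - (int j - m * int N) - of_bool (tailed x i)"
        unfolding x y by simp_all
      then show ?thesis unfolding laurent_term_def affine_factor_def by (simp only:)
    qed
    then show "bethe_entry z 0 x y (- of_bool (tailed x i)) i j
      = (\<Sum>m\<in>{- K..<K}. z powi (int L * m) * affine_factor x y i (int j - m * int N))"
      unfolding bethe_entry_def using \<kappa>_le[OF i j]
      by (subst root_trace_finite_sum[of _ _ _ K]) (simp_all only: \<kappa>_def prod.case terms cong: sum.cong)
  qed
qed

section \<open>Constant terms and the transition probability\<close>

definition constant_term :: "(real \<Rightarrow> complex) \<Rightarrow> (complex \<Rightarrow> complex) \<Rightarrow> complex" where
  "constant_term \<Gamma> h = contour_integral \<Gamma> (\<lambda>z. h z / (2 * of_real pi * \<i> * z))"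

end

locale periodic_tasep_contour = periodic_tasep +
  fixes \<Gamma> :: "real \<Rightarrow> complex"
  assumes contour: "simple_contour_around \<Gamma> 0"
begin

lemma contour_facts: "valid_path \<Gamma>" "pathfinish \<Gamma> = pathstart \<Gamma>" "path_image \<Gamma> \<subseteq> - {0}" "winding_number \<Gamma> 0 = 1"
  using contour inside_no_overlap[of "path_image \<Gamma>"] unfolding simple_contour_around_def by blast+

lemma constant_term_integrable:
  assumes "h holomorphic_on - {0}"
  shows "(\<lambda>z. h z / (2 * of_real pi * \<i> * z)) contour_integrable_on \<Gamma>"
  using assms contour_facts
  by (intro contour_integrable_holomorphic_simple[of _ "- {0}"] holomorphic_intros) auto

lemma constant_term_sum:
  assumes "finite A" "\<And>a. a \<in> A \<Longrightarrow> h a holomorphic_on - {0}"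
  shows "constant_term \<Gamma> (\<lambda>z. \<Sum>a\<in>A. c a * h a z) = (\<Sum>a\<in>A. c a * constant_term \<Gamma> (h a))"
proof -
  have "(\<lambda>z. (\<Sum>a\<in>A. c a * h a z) / (2 * of_real pi * \<i> * z))
      = (\<lambda>z. \<Sum>a\<in>A. c a * (h a z / (2 * of_real pi * \<i> * z)))"
    by (simp add: sum_divide_distrib)
  moreover have "contour_integral \<Gamma> (\<lambda>z. \<Sum>a\<in>A. c a * (h a z / (2 * of_real pi * \<i> * z)))
      = (\<Sum>a\<in>A. contour_integral \<Gamma> (\<lambda>z. c a * (h a z / (2 * of_real pi * \<i> * z))))"
    using assms by (intro contour_integral_sum contour_integrable_lmul constant_term_integrable)
  moreover have "contour_integral \<Gamma> (\<lambda>z. c a * (h a z / (2 * of_real pi * \<i> * z)))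
      = c a * constant_term \<Gamma> (h a)" if "a \<in> A" for a
    unfolding constant_term_def using assms that by (intro contour_integral_lmul constant_term_integrable)
  ultimately show ?thesis by (simp add: constant_term_def)
qed

lemma constant_term_cong:
  assumes "\<And>z. z \<noteq> 0 \<Longrightarrow> f z = g z"
  shows "constant_term \<Gamma> f = constant_term \<Gamma> g"
  unfolding constant_term_def using assms contour_facts(3) by (intro contour_integral_eq) auto

text \<open>All powers \<open>z powi n / z\<close> have a primitive on the punctured plane, except for \<open>n = 0\<close>, which gives the winding number.\<close>

lemma constant_term_power: "constant_term \<Gamma> (\<lambda>z. z powi n) = of_bool (n = 0)"
proof (cases "n = 0")
  case True
  define c :: complex where "c = 2 * of_real pi * \<i>"
  have c: "c \<noteq> 0" by (simp add: c_def)
  have "(\<lambda>z. c / (c * z)) contour_integrable_on \<Gamma>"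
    unfolding c_def by (intro constant_term_integrable) auto
  then have "contour_integral \<Gamma> (\<lambda>z. inverse c * (c / (c * z))) = inverse c * contour_integral \<Gamma> (\<lambda>z. c / (c * z))"
    by (rule contour_integral_lmul)
  moreover have "contour_integral \<Gamma> (\<lambda>z. c / (c * z)) = c"
    using contour_facts winding_number_valid_path[of \<Gamma> 0] c by (simp add: c_def)
  moreover have "inverse c * (c / (c * z)) = z powi n / (c * z)" for z
    using c True by (simp add: inverse_eq_divide)
  ultimately show ?thesis
    unfolding constant_term_def c_def[symmetric] using c True by simp
next
  case False
  have "((\<lambda>z. z powi n / (2 * of_real pi * \<i> * z)) has_contour_integral
      pathfinish \<Gamma> powi n / (of_int n * (2 * of_real pi * \<i>)) - pathstart \<Gamma> powi n / (of_int n * (2 * of_real pi * \<i>))) \<Gamma>"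
  proof (rule contour_integral_primitive[where S = "- {0}"])
    fix z :: complex assume "z \<in> - {0}"
    then have z: "z \<noteq> 0" by simp
    then have "((\<lambda>z. z powi n / (of_int n * (2 * of_real pi * \<i>))) has_field_derivative
        of_int n * z powi (n - 1) * 1 / (of_int n * (2 * of_real pi * \<i>))) (at z within - {0})"
      by (intro DERIV_cdivide DERIV_power_int) (auto intro!: derivative_eq_intros)
    moreover have "of_int n * z powi (n - 1) * 1 / (of_int n * (2 * of_real pi * \<i>)) = z powi n / (2 * of_real pi * \<i> * z)"
      using z False by (simp add: power_int_diff field_simps)
    ultimately show "((\<lambda>z. z powi n / (of_int n * (2 * of_real pi * \<i>))) has_field_derivative
        z powi n / (2 * of_real pi * \<i> * z)) (at z within - {0})" by simp
  qed (use contour_facts in auto)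
  then show ?thesis
    using False contour_facts(2) by (simp add: constant_term_def contour_integral_unique)
qed

lemma det_bethe_mat_holomorphic: "(\<lambda>z. Determinant.det (bethe_mat z t x y s)) holomorphic_on - {0}"
  unfolding det_bethe_mat_expand bethe_entry_def
  by (intro holomorphic_intros root_trace_holomorphic) auto

text \<open>
  Expanding the determinant over permutations and each entry in powers of \<open>z ^ L\<close>, the constant
  term selects the pairs of a permutation and shifts with total degree zero, to which
  \<open>affine_permutation_trivial\<close> applies.
\<close>

theorem constant_term_initial:
  assumes x: "x \<in> configs N L" and y: "y \<in> configs N L"
  shows "of_real (blocking_factor x) * constant_term \<Gamma> (\<lambda>z. Determinant.det (bethe_mat z 0 x y (\<lambda>_. 0))) = of_bool (x = y)"
proof -
  let ?P = "{\<pi>. \<pi> permutes {0..<N}}"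
  obtain K where K0: "0 < K" and K: "\<forall>z. \<forall>i<N. \<forall>j<N. bethe_entry z 0 x y (- of_bool (tailed x i)) i j
    = (\<Sum>m\<in>{- K..<K}. z powi (int L * m) * affine_factor x y i (int j - m * int N))"
    using bethe_entry_laurent[of x y] by blast
  define c where "c = (\<lambda>(\<pi>, g). signof \<pi> * (\<Prod>i = 0..<N. affine_factor x y i (int (\<pi> i) - g i * int N)))"
  let ?G = "PiE {0..<N} (\<lambda>_. {- K..<K})"
  let ?zero = "\<lambda>i\<in>{0..<N}. 0::int"
  have fin: "finite (?P \<times> ?G)" by (intro finite_cartesian_product finite_permutations finite_PiE) auto
  have "constant_term \<Gamma> (\<lambda>z. Determinant.det (bethe_mat z 0 x y (\<lambda>_. 0)))
      = constant_term \<Gamma> (\<lambda>z. \<Sum>a\<in>?P \<times> ?G. c a * z powi (int L * (\<Sum>i = 0..<N. snd a i)))"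
  proof (rule constant_term_cong)
    fix z :: complex assume z: "z \<noteq> 0"
    have expand: "(\<Prod>i = 0..<N. bethe_entry z 0 x y (- of_bool (tailed x i)) i (\<pi> i))
        = (\<Sum>g\<in>?G. (\<Prod>i = 0..<N. affine_factor x y i (int (\<pi> i) - g i * int N)) * z powi (int L * (\<Sum>i = 0..<N. g i)))"
      if "\<pi> \<in> ?P" for \<pi>
    proof -
      have "(\<Prod>i = 0..<N. bethe_entry z 0 x y (- of_bool (tailed x i)) i (\<pi> i))
        = (\<Prod>i = 0..<N. \<Sum>m\<in>{- K..<K}. z powi (int L * m) * affine_factor x y i (int (\<pi> i) - m * int N))"
        using that permutes_in_image[of \<pi> "{0..<N}"] by (intro prod.cong K[rule_format] refl) auto
      also have "\<dots> = (\<Sum>g\<in>?G. \<Prod>i = 0..<N. z powi (int L * g i) * affine_factor x y i (int (\<pi> i) - g i * int N))"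
        by (rule prod_sum_PiE) auto
      also have "\<dots> = (\<Sum>g\<in>?G. (\<Prod>i = 0..<N. affine_factor x y i (int (\<pi> i) - g i * int N)) * z powi (int L * (\<Sum>i = 0..<N. g i)))"
      proof (intro sum.cong refl)
        fix g :: "nat \<Rightarrow> int"
        have "(\<Prod>i\<in>A. z powi (int L * g i)) = z powi (int L * (\<Sum>i\<in>A. g i))" if "finite A" for A
          using that by (induction A rule: finite_induct) (use z in \<open>auto simp: distrib_left power_int_add\<close>)
        then show "(\<Prod>i = 0..<N. z powi (int L * g i) * affine_factor x y i (int (\<pi> i) - g i * int N))
          = (\<Prod>i = 0..<N. affine_factor x y i (int (\<pi> i) - g i * int N)) * z powi (int L * (\<Sum>i = 0..<N. g i))"
          by (simp add: prod.distrib mult.commute)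
      qed
      finally show ?thesis .
    qed
    have "Determinant.det (bethe_mat z 0 x y (\<lambda>_. 0))
        = (\<Sum>\<pi>\<in>?P. signof \<pi> * (\<Prod>i = 0..<N. bethe_entry z 0 x y (- of_bool (tailed x i)) i (\<pi> i)))"
      using det_bethe_mat_tailed[OF z, of 0 x y 0] by (simp add: det_bethe_mat_expand)
    also have "\<dots> = (\<Sum>\<pi>\<in>?P. \<Sum>g\<in>?G. c (\<pi>, g) * z powi (int L * (\<Sum>i = 0..<N. g i)))"
      by (intro sum.cong refl, subst expand) (simp_all add: c_def sum_distrib_left mult.assoc)
    also have "\<dots> = (\<Sum>a\<in>?P \<times> ?G. c a * z powi (int L * (\<Sum>i = 0..<N. snd a i)))"
      by (simp add: sum.cartesian_product case_prod_beta)
    finally show "Determinant.det (bethe_mat z 0 x y (\<lambda>_. 0))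
        = (\<Sum>a\<in>?P \<times> ?G. c a * z powi (int L * (\<Sum>i = 0..<N. snd a i)))" .
  qed
  also have "\<dots> = (\<Sum>a\<in>?P \<times> ?G. c a * constant_term \<Gamma> (\<lambda>z. z powi (int L * (\<Sum>i = 0..<N. snd a i))))"
    using fin by (rule constant_term_sum) (auto intro!: holomorphic_intros)
  also have "\<dots> = (\<Sum>a\<in>{(id, ?zero)}. c a * constant_term \<Gamma> (\<lambda>z. z powi (int L * (\<Sum>i = 0..<N. snd a i))))"
  proof (rule sum.mono_neutral_right[OF fin])
    show "{(id, ?zero)} \<subseteq> ?P \<times> ?G" using K0 by (auto simp: permutes_id)
    show "\<forall>a\<in>?P \<times> ?G - {(id, ?zero)}. c a * constant_term \<Gamma> (\<lambda>z. z powi (int L * (\<Sum>i = 0..<N. snd a i))) = 0"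
    proof (rule ballI, rule ccontr)
      fix a assume a: "a \<in> ?P \<times> ?G - {(id, ?zero)}"
        and nz: "c a * constant_term \<Gamma> (\<lambda>z. z powi (int L * (\<Sum>i = 0..<N. snd a i))) \<noteq> 0"
      obtain \<pi> g where ag: "a = (\<pi>, g)" by (cases a)
      have perm: "\<pi> permutes {0..<N}" and g: "g \<in> extensional {0..<N}" using a ag by (auto simp: PiE_def)
      have deg: "(\<Sum>i = 0..<N. g i) = 0" using nz ag N_less by (simp add: constant_term_power split: if_splits)
      have "affine_factor x y i (int (\<pi> i) - g i * int N) \<noteq> 0" if "i < N" for i
      proof
        assume "affine_factor x y i (int (\<pi> i) - g i * int N) = 0"
        then have "(\<Prod>i = 0..<N. affine_factor x y i (int (\<pi> i) - g i * int N)) = 0"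
          using that by (intro prod_zero) auto
        then show False using nz ag by (simp add: c_def)
      qed
      note triv = affine_permutation_trivial[OF x y perm deg this]
      have "\<pi> = id"
        using triv(1) permutes_not_in[OF perm] by (metis atLeastLessThan_iff eq_id_iff le0)
      moreover have "g = ?zero" using triv(2) g by (intro extensionalityI[OF g]) auto
      ultimately show False using a ag by simp
    qed
  qed
  also have "\<dots> = (\<Prod>i = 0..<N. affine_factor x y i (int i))"
    by (simp add: constant_term_power[of 0, simplified] c_def)
  finally show ?thesis using affine_factor_diagonal[OF x y] by simp
qed

theorem trans_prob_eq_constant_term:
  assumes y: "y \<in> configs N L" and x: "x \<in> configs N L"
  shows "of_real (trans_prob N L p t y x)
    = of_real (blocking_factor x) * constant_term \<Gamma> (\<lambda>z. Determinant.det (bethe_mat z t x y (\<lambda>_. 0)))"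
  using x
proof (induction t arbitrary: x)
  case 0
  then show ?case using constant_term_initial[OF 0 y] by (auto simp: trans_prob_def pmf_return)
next
  case (Suc t)
  let ?w = "\<lambda>e. complex_of_real (\<Prod>i\<in>{1..N}. hop_weight (e i))"
  have "of_real (trans_prob N L p (Suc t) y x)
      = (\<Sum>e\<in>hops x. ?w e * (of_real (trans_prob N L p t y (undo x e)) / of_real (blocking_factor (undo x e))))"
    unfolding trans_prob_Suc[OF Suc.prems y] by (simp only: of_real_sum of_real_mult of_real_divide)
  also have "\<dots> = (\<Sum>e\<in>hops x. ?w e * constant_term \<Gamma> (\<lambda>z. Determinant.det (bethe_mat z t (undo x e) y (\<lambda>_. 0))))"
  proof (intro sum.cong arg_cong2[where f = "(*)"] refl)
    fix e assume "e \<in> hops x"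
    then show "of_real (trans_prob N L p t y (undo x e)) / of_real (blocking_factor (undo x e))
      = constant_term \<Gamma> (\<lambda>z. Determinant.det (bethe_mat z t (undo x e) y (\<lambda>_. 0)))"
      using Suc.IH[OF undo_configs[OF Suc.prems]] blocking_factor_pos[of "undo x e"] by simp
  qed
  also have "\<dots> = constant_term \<Gamma> (\<lambda>z. \<Sum>e\<in>hops x. ?w e * Determinant.det (bethe_mat z t (undo x e) y (\<lambda>_. 0)))"
    using finite_hops det_bethe_mat_holomorphic by (intro constant_term_sum[symmetric])
  also have "\<dots> = constant_term \<Gamma> (\<lambda>z. of_real (blocking_factor x) * Determinant.det (bethe_mat z (Suc t) x y (\<lambda>_. 0)))"
    by (rule constant_term_cong) (rule det_bethe_mat_Suc[symmetric])
  also have "\<dots> = of_real (blocking_factor x) * constant_term \<Gamma> (\<lambda>z. Determinant.det (bethe_mat z (Suc t) x y (\<lambda>_. 0)))"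
    using constant_term_sum[of "{()}" "\<lambda>_ z. Determinant.det (bethe_mat z (Suc t) x y (\<lambda>_. 0))"]
      det_bethe_mat_holomorphic by simp
  finally show ?case .
qed

end

theorem proposition3p1:
  fixes N L t :: nat and p :: real and x y :: "nat \<Rightarrow> int" and \<Gamma> :: "real \<Rightarrow> complex"
  assumes "1 \<le> N" and "N < L"
    and "0 < p" and "p < 1"
    and "x \<in> configs N L" and "y \<in> configs N L"
    and "simple_contour_around \<Gamma> 0"
  shows "complex_of_real (trans_prob N L p t y x) =
           complex_of_real (\<Prod>i=1..N. 1 - p * of_bool (right_nbr N L x i - x i = 1))
           * contour_integral \<Gamma>
               (\<lambda>z. Determinant.det (root_sum_mat N L p x y t z) / (2 * of_real pi * \<i> * z))"
proof -
  interpret periodic_tasep_contour N L p \<Gamma>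
    using assms by unfold_locales auto
  have "of_real (trans_prob N L p t y x)
      = of_real (blocking_factor x) * constant_term \<Gamma> (\<lambda>z. Determinant.det (bethe_mat z t x y (\<lambda>_. 0)))"
    using assms by (intro trans_prob_eq_constant_term)
  also have "constant_term \<Gamma> (\<lambda>z. Determinant.det (bethe_mat z t x y (\<lambda>_. 0)))
      = constant_term \<Gamma> (\<lambda>z. Determinant.det (root_sum_mat N L p x y t z))"
    by (rule constant_term_cong) (simp add: root_sum_mat_eq)
  finally show ?thesis unfolding constant_term_def blocking_factor_def .
qed

end
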